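(* Let $L$ be a finite-dimensional Lie algebra over a field $F$. (1) If $L$ is solvable and every two-generated proper subalgebra of $L$ is triangulable on $L$, then $L$ is triangulable. (2) If every proper subalgebra of $L$ is triangulable on $L$ but $L$ itself is not triangulable, then $L$ is two-generated and $L/\phi(L)$ is simple; moreover, $\bar L=L/\phi(L)$ satisfies: (a) for each maximal subalgebra $M$ of $\bar L$, either $M$ is abelian and no non-zero element of $M$ acts nilpotently on $\bar L$, or $\mathrm{nil}(M)$ is a non-zero maximal nil subalgebra of $\bar L$; (b) for each non-zero maximal nil subalgebra $K$ of $\bar L$, $N_{\bar L}(K)$ is a maximal subalgebra of $\bar L$; (c) for any two different maximal subalgebras $M_1,M_2$ of $\bar L$, no non-zero element of $M_1\cap M_2$ acts nilpotently on $\bar L$ (in particular $M_1\cap M_2$ is abelian); (d) $\bar L$ is two-generated.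
   Context: A subalgebra $S$ of a Lie algebra $L$ is triangulable on $L$ if $\mathrm{ad}_L S=\{\mathrm{ad}_L x\mid x\in S\}$ is a Lie algebra of linear transformations of $L$ which is simultaneously triangulable over the algebraic closure of $F$ (equivalently, every element of $S^2$ acts nilpotently on $L$); $L$ is triangulable if it is triangulable on itself. An element $x$ acts nilpotently on $L$ if $\mathrm{ad}_L x$ is nilpotent; a subalgebra is nil on $L$ if all its elements act nilpotently on $L$, and a maximal nil subalgebra is one maximal among subalgebras nil on $L$. For a subalgebra $S$, $\mathrm{nil}(S)$ is the unique maximal ideal of $S$ consisting of elements acting nilpotently on $L$. The Frattini ideal $\phi(L)$ is the largest ideal of $L$ contained in the intersection of all maximal subalgebras of $L$. A Lie algebra is two-generated if it is generated by two of its elements. *)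

theory Defs
  imports Main
begin

record ('k, 'a) lie_alg =
  lcarrier :: "'a set"
  ladd :: "'a \<Rightarrow> 'a \<Rightarrow> 'a"
  lzero :: "'a"
  lsmult :: "'k \<Rightarrow> 'a \<Rightarrow> 'a"
  lbr :: "'a \<Rightarrow> 'a \<Rightarrow> 'a"

definition lie_algebra :: "('k::field, 'a) lie_alg \<Rightarrow> bool" where
  "lie_algebra L \<longleftrightarrow>
     lzero L \<in> lcarrier L \<and>
     (\<forall>x\<in>lcarrier L. \<forall>y\<in>lcarrier L. ladd L x y \<in> lcarrier L) \<and>
     (\<forall>c. \<forall>x\<in>lcarrier L. lsmult L c x \<in> lcarrier L) \<and>
     (\<forall>x\<in>lcarrier L. \<forall>y\<in>lcarrier L. lbr L x y \<in> lcarrier L) \<and>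
     (\<forall>x\<in>lcarrier L. \<forall>y\<in>lcarrier L. \<forall>z\<in>lcarrier L.
         ladd L (ladd L x y) z = ladd L x (ladd L y z)) \<and>
     (\<forall>x\<in>lcarrier L. \<forall>y\<in>lcarrier L. ladd L x y = ladd L y x) \<and>
     (\<forall>x\<in>lcarrier L. ladd L (lzero L) x = x) \<and>
     (\<forall>x\<in>lcarrier L. \<exists>y\<in>lcarrier L. ladd L x y = lzero L) \<and>
     (\<forall>c. \<forall>x\<in>lcarrier L. \<forall>y\<in>lcarrier L.
         lsmult L c (ladd L x y) = ladd L (lsmult L c x) (lsmult L c y)) \<and>
     (\<forall>c d. \<forall>x\<in>lcarrier L. lsmult L (c + d) x = ladd L (lsmult L c x) (lsmult L d x)) \<and>
     (\<forall>c d. \<forall>x\<in>lcarrier L. lsmult L (c * d) x = lsmult L c (lsmult L d x)) \<and>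
     (\<forall>x\<in>lcarrier L. lsmult L 1 x = x) \<and>
     (\<forall>x\<in>lcarrier L. \<forall>y\<in>lcarrier L. \<forall>z\<in>lcarrier L.
         lbr L (ladd L x y) z = ladd L (lbr L x z) (lbr L y z) \<and>
         lbr L z (ladd L x y) = ladd L (lbr L z x) (lbr L z y)) \<and>
     (\<forall>c. \<forall>x\<in>lcarrier L. \<forall>y\<in>lcarrier L.
         lbr L (lsmult L c x) y = lsmult L c (lbr L x y) \<and>
         lbr L x (lsmult L c y) = lsmult L c (lbr L x y)) \<and>
     (\<forall>x\<in>lcarrier L. lbr L x x = lzero L) \<and>
     (\<forall>x\<in>lcarrier L. \<forall>y\<in>lcarrier L. \<forall>z\<in>lcarrier L.
         ladd L (lbr L x (lbr L y z)) (ladd L (lbr L y (lbr L z x)) (lbr L z (lbr L x y)))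
           = lzero L)"

definition subspace :: "('k::field, 'a) lie_alg \<Rightarrow> 'a set \<Rightarrow> bool" where
  "subspace L V \<longleftrightarrow> V \<subseteq> lcarrier L \<and> lzero L \<in> V \<and>
     (\<forall>x\<in>V. \<forall>y\<in>V. ladd L x y \<in> V) \<and> (\<forall>c. \<forall>x\<in>V. lsmult L c x \<in> V)"

definition span :: "('k::field, 'a) lie_alg \<Rightarrow> 'a set \<Rightarrow> 'a set" where
  "span L S = \<Inter>{V. subspace L V \<and> S \<subseteq> V}"

definition fin_dim :: "('k::field, 'a) lie_alg \<Rightarrow> bool" where
  "fin_dim L \<longleftrightarrow> (\<exists>S. finite S \<and> S \<subseteq> lcarrier L \<and> span L S = lcarrier L)"

definition brspan :: "('k::field, 'a) lie_alg \<Rightarrow> 'a set \<Rightarrow> 'a set \<Rightarrow> 'a set" where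
  "brspan L A B = span L {lbr L a b | a b. a \<in> A \<and> b \<in> B}"

definition subalgebra :: "('k::field, 'a) lie_alg \<Rightarrow> 'a set \<Rightarrow> bool" where
  "subalgebra L S \<longleftrightarrow> subspace L S \<and> (\<forall>x\<in>S. \<forall>y\<in>S. lbr L x y \<in> S)"

definition ideal :: "('k::field, 'a) lie_alg \<Rightarrow> 'a set \<Rightarrow> bool" where
  "ideal L I \<longleftrightarrow> subspace L I \<and> (\<forall>x\<in>lcarrier L. \<forall>y\<in>I. lbr L x y \<in> I)"

definition ideal_of :: "('k::field, 'a) lie_alg \<Rightarrow> 'a set \<Rightarrow> 'a set \<Rightarrow> bool" where
  "ideal_of L S I \<longleftrightarrow> subspace L I \<and> I \<subseteq> S \<and> (\<forall>x\<in>S. \<forall>y\<in>I. lbr L x y \<in> I)"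

definition gen :: "('k::field, 'a) lie_alg \<Rightarrow> 'a set \<Rightarrow> 'a set" where
  "gen L X = \<Inter>{S. subalgebra L S \<and> X \<subseteq> S}"

definition two_gen :: "('k::field, 'a) lie_alg \<Rightarrow> 'a set \<Rightarrow> bool" where
  "two_gen L S \<longleftrightarrow> (\<exists>x\<in>S. \<exists>y\<in>S. gen L {x, y} = S)"

definition ad :: "('k::field, 'a) lie_alg \<Rightarrow> 'a \<Rightarrow> 'a \<Rightarrow> 'a" where
  "ad L x = (\<lambda>y. lbr L x y)"

definition acts_nil :: "('k::field, 'a) lie_alg \<Rightarrow> 'a \<Rightarrow> bool" where
  "acts_nil L x \<longleftrightarrow> (\<exists>n. \<forall>y\<in>lcarrier L. (ad L x ^^ n) y = lzero L)"

definition triang_on :: "('k::field, 'a) lie_alg \<Rightarrow> 'a set \<Rightarrow> bool" where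
  "triang_on L S \<longleftrightarrow> (\<forall>x\<in>brspan L S S. acts_nil L x)"

definition triangulable :: "('k::field, 'a) lie_alg \<Rightarrow> bool" where
  "triangulable L \<longleftrightarrow> triang_on L (lcarrier L)"

fun derived :: "('k::field, 'a) lie_alg \<Rightarrow> nat \<Rightarrow> 'a set" where
  "derived L 0 = lcarrier L"
| "derived L (Suc n) = brspan L (derived L n) (derived L n)"

definition solvable :: "('k::field, 'a) lie_alg \<Rightarrow> bool" where
  "solvable L \<longleftrightarrow> (\<exists>n. derived L n = {lzero L})"

definition abelian :: "('k::field, 'a) lie_alg \<Rightarrow> 'a set \<Rightarrow> bool" where
  "abelian L S \<longleftrightarrow> (\<forall>x\<in>S. \<forall>y\<in>S. lbr L x y = lzero L)"

definition max_subalg :: "('k::field, 'a) lie_alg \<Rightarrow> 'a set \<Rightarrow> bool" where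
  "max_subalg L M \<longleftrightarrow> subalgebra L M \<and> M \<noteq> lcarrier L \<and>
     (\<forall>S. subalgebra L S \<and> M \<subseteq> S \<longrightarrow> S = M \<or> S = lcarrier L)"

definition nil_subalg :: "('k::field, 'a) lie_alg \<Rightarrow> 'a set \<Rightarrow> bool" where
  "nil_subalg L S \<longleftrightarrow> subalgebra L S \<and> (\<forall>x\<in>S. acts_nil L x)"

definition max_nil :: "('k::field, 'a) lie_alg \<Rightarrow> 'a set \<Rightarrow> bool" where
  "max_nil L K \<longleftrightarrow> nil_subalg L K \<and> (\<forall>S. nil_subalg L S \<and> K \<subseteq> S \<longrightarrow> S = K)"

definition nil :: "('k::field, 'a) lie_alg \<Rightarrow> 'a set \<Rightarrow> 'a set" where
  "nil L S = (THE I. ideal_of L S I \<and> (\<forall>x\<in>I. acts_nil L x) \<and>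
       (\<forall>J. ideal_of L S J \<and> (\<forall>x\<in>J. acts_nil L x) \<longrightarrow> J \<subseteq> I))"

definition normalizer :: "('k::field, 'a) lie_alg \<Rightarrow> 'a set \<Rightarrow> 'a set" where
  "normalizer L K = {x \<in> lcarrier L. \<forall>k\<in>K. lbr L x k \<in> K}"

definition frattini :: "('k::field, 'a) lie_alg \<Rightarrow> 'a set" where
  "frattini L = (THE I. ideal L I \<and> I \<subseteq> \<Inter>{M. max_subalg L M} \<and>
       (\<forall>J. ideal L J \<and> J \<subseteq> \<Inter>{M. max_subalg L M} \<longrightarrow> J \<subseteq> I))"

definition simple :: "('k::field, 'a) lie_alg \<Rightarrow> bool" where
  "simple L \<longleftrightarrow> \<not> abelian L (lcarrier L) \<and>
     (\<forall>I. ideal L I \<longrightarrow> I = {lzero L} \<or> I = lcarrier L)"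

definition coset :: "('k::field, 'a) lie_alg \<Rightarrow> 'a set \<Rightarrow> 'a \<Rightarrow> 'a set" where
  "coset L I x = {ladd L x i | i. i \<in> I}"

definition rep :: "'a set \<Rightarrow> 'a" where
  "rep A = (SOME a. a \<in> A)"

definition quot :: "('k::field, 'a) lie_alg \<Rightarrow> 'a set \<Rightarrow> ('k, 'a set) lie_alg" where
  "quot L I = \<lparr> lcarrier = coset L I ` lcarrier L,
      ladd = (\<lambda>A B. coset L I (ladd L (rep A) (rep B))),
      lzero = coset L I (lzero L),
      lsmult = (\<lambda>c A. coset L I (lsmult L c (rep A))),
      lbr = (\<lambda>A B. coset L I (lbr L (rep A) (rep B))) \<rparr>"

end

(*
  The key tool is Jacobson's theorem: if a set W of elements acting nilpotently on L is closed
  under brackets, then span W acts nilpotently. Applied to the brackets [x, y] it shows that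
  triangulability is detected on two-generated subalgebras, so a minimal non-triangulable L is
  two-generated; applied to S^2 and the nil elements of a triangulable S it shows that nil(S)
  is the set of all elements of S acting nilpotently on L.

  Let L be minimal non-triangulable. By Fitting's decomposition, an element acting nilpotently
  on L / phi(L) acts nilpotently on L. An ideal I not contained in phi(L) has a supplement M,
  and since I and M are triangulable, comparing actions on L / I and on I / phi(L) makes L
  triangulable unless I = L. So L / phi(L) is simple, which excludes solvable L. In the simple
  algebra the normaliser of a nonzero nil subalgebra is a proper subalgebra and, by Engel, proper
  subalgebras of nil subalgebras are smaller than their normalisers there; this gives (a)-(c).
*)
theory Submission
  imports Defs
begin

text \<open>Triangulability quantifies over the span of all brackets, and a sum of nilpotent maps
  need not be nilpotent, while the reduction to two generators controls only single brackets. So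
  Jacobson's theorem is needed for bracket-closed sets that are not subspaces, where Engel's theorem
  for subalgebras does not apply. Over an arbitrary field eigenvalues may be missing, so joint
  nilpotency is expressed by \<open>nilset\<close>: products of enough maps \<open>ad L a\<close>
  with \<open>a\<close> in \<open>A\<close> vanish on all of \<open>L\<close>. In finite dimension
  this means that no nonzero subspace \<open>U\<close> satisfies \<open>brspan L A U = U\<close>;
  this fixed-subspace test takes the place of flags and dimension formulas. Nilpotency always refers
  to \<open>L\<close>, never to the subalgebra, so what is learnt modulo \<open>frattini L\<close>
  has to be lifted back to \<open>L\<close>.\<close>

section \<open>Arithmetic in the carrier of a Lie algebra\<close>

locale lie =
  fixes L :: "('k::field, 'a) lie_alg"
  assumes lie_algebra: "lie_algebra L"
begin

abbreviation carr ("C") where "C \<equiv> lcarrier L"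
abbreviation add (infixl "\<oplus>" 65) where "x \<oplus> y \<equiv> ladd L x y"
abbreviation zero ("\<zero>") where "\<zero> \<equiv> lzero L"
abbreviation scale (infixr "\<odot>" 75) where "c \<odot> x \<equiv> lsmult L c x"
abbreviation bracket (infixl "\<bullet>" 70) where "x \<bullet> y \<equiv> lbr L x y"

lemma zero_closed [simp]: "\<zero> \<in> C"
  and add_closed [simp]: "x \<in> C \<Longrightarrow> y \<in> C \<Longrightarrow> x \<oplus> y \<in> C"
  and scale_closed [simp]: "x \<in> C \<Longrightarrow> c \<odot> x \<in> C"
  and br_closed [simp]: "x \<in> C \<Longrightarrow> y \<in> C \<Longrightarrow> x \<bullet> y \<in> C"
  and scale_add: "x \<in> C \<Longrightarrow> y \<in> C \<Longrightarrow> c \<odot> (x \<oplus> y) = c \<odot> x \<oplus> c \<odot> y"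
  and add_scale: "x \<in> C \<Longrightarrow> (c + d) \<odot> x = c \<odot> x \<oplus> d \<odot> x"
  and scale_scale [simp]: "x \<in> C \<Longrightarrow> c \<odot> d \<odot> x = (c * d) \<odot> x"
  and scale_one [simp]: "x \<in> C \<Longrightarrow> 1 \<odot> x = x"
  and br_add_left: "x \<in> C \<Longrightarrow> y \<in> C \<Longrightarrow> z \<in> C \<Longrightarrow> (x \<oplus> y) \<bullet> z = x \<bullet> z \<oplus> y \<bullet> z"
  and br_add_right: "x \<in> C \<Longrightarrow> y \<in> C \<Longrightarrow> z \<in> C \<Longrightarrow> z \<bullet> (x \<oplus> y) = z \<bullet> x \<oplus> z \<bullet> y"
  and br_scale_left [simp]: "x \<in> C \<Longrightarrow> y \<in> C \<Longrightarrow> (c \<odot> x) \<bullet> y = c \<odot> (x \<bullet> y)"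
  and br_scale_right [simp]: "x \<in> C \<Longrightarrow> y \<in> C \<Longrightarrow> x \<bullet> (c \<odot> y) = c \<odot> (x \<bullet> y)"
  and br_self [simp]: "x \<in> C \<Longrightarrow> x \<bullet> x = \<zero>"
  and jacobi: "x \<in> C \<Longrightarrow> y \<in> C \<Longrightarrow> z \<in> C \<Longrightarrow>
    x \<bullet> (y \<bullet> z) \<oplus> (y \<bullet> (z \<bullet> x) \<oplus> z \<bullet> (x \<bullet> y)) = \<zero>"
  using lie_algebra unfolding lie_algebra_def by simp_all

lemma add_assoc: "x \<in> C \<Longrightarrow> y \<in> C \<Longrightarrow> z \<in> C \<Longrightarrow> x \<oplus> y \<oplus> z = x \<oplus> (y \<oplus> z)"
  and add_commute: "x \<in> C \<Longrightarrow> y \<in> C \<Longrightarrow> x \<oplus> y = y \<oplus> x"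
  and zero_add [simp]: "x \<in> C \<Longrightarrow> \<zero> \<oplus> x = x"
  and inverse_exists: "x \<in> C \<Longrightarrow> \<exists>y\<in>C. x \<oplus> y = \<zero>"
  using lie_algebra unfolding lie_algebra_def by metis+

lemma add_zero [simp]: "x \<in> C \<Longrightarrow> x \<oplus> \<zero> = x"
  by (metis add_commute zero_add zero_closed)

lemma add_left_commute: "x \<in> C \<Longrightarrow> y \<in> C \<Longrightarrow> z \<in> C \<Longrightarrow> x \<oplus> (y \<oplus> z) = y \<oplus> (x \<oplus> z)"
  by (metis add_assoc add_commute)

lemmas add_ac = add_assoc add_commute add_left_commute

lemma add_left_cancel:
  assumes "x \<in> C" "y \<in> C" "z \<in> C" "x \<oplus> y = x \<oplus> z"
  shows "y = z"
proof -
  obtain w where w: "w \<in> C" "w \<oplus> x = \<zero>"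
    using inverse_exists[OF assms(1)] add_commute assms(1) by metis
  have "w \<oplus> x \<oplus> y = w \<oplus> x \<oplus> z"
    using assms(1-3) w(1) by (simp add: add_assoc assms(4))
  then show ?thesis using assms(2,3) w by simp
qed

lemma zero_scale [simp]:
  assumes x: "x \<in> C"
  shows "0 \<odot> x = \<zero>"
proof (rule add_left_cancel)
  show "0 \<odot> x \<oplus> 0 \<odot> x = 0 \<odot> x \<oplus> \<zero>"
    using add_scale[OF x, of 0 0] x by simp
qed (use x in auto)

lemma scale_zero [simp]: "c \<odot> \<zero> = \<zero>"
  by (metis mult_zero_right scale_scale zero_closed zero_scale)

lemma add_neg [simp]: "x \<in> C \<Longrightarrow> x \<oplus> (-1) \<odot> x = \<zero>"
  by (metis add_scale add.right_inverse scale_one zero_scale)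

lemma neg_add [simp]: "x \<in> C \<Longrightarrow> (-1) \<odot> x \<oplus> x = \<zero>"
  by (metis add_commute add_neg scale_closed)

lemma add_neg_cancel [simp]: "x \<in> C \<Longrightarrow> y \<in> C \<Longrightarrow> x \<oplus> ((-1) \<odot> x \<oplus> y) = y"
  by (simp flip: add_assoc)

lemma neg_add_cancel [simp]: "x \<in> C \<Longrightarrow> y \<in> C \<Longrightarrow> (-1) \<odot> x \<oplus> (x \<oplus> y) = y"
  by (simp flip: add_assoc)

lemma zero_br [simp]: "x \<in> C \<Longrightarrow> \<zero> \<bullet> x = \<zero>"
  by (metis br_closed br_scale_left zero_closed zero_scale)

lemma br_zero [simp]: "x \<in> C \<Longrightarrow> x \<bullet> \<zero> = \<zero>"
  by (metis br_closed br_scale_right zero_closed zero_scale)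

lemma br_anti:
  assumes [simp]: "x \<in> C" "y \<in> C"
  shows "y \<bullet> x = (-1) \<odot> (x \<bullet> y)"
proof -
  have "\<zero> = (x \<oplus> y) \<bullet> (x \<oplus> y)" by simp
  also have "\<dots> = x \<bullet> y \<oplus> y \<bullet> x"
    by (subst br_add_left) (simp_all add: br_add_right)
  finally have "(-1) \<odot> (x \<bullet> y) \<oplus> (x \<bullet> y \<oplus> y \<bullet> x) = (-1) \<odot> (x \<bullet> y)"
    by (metis add_zero assms br_closed scale_closed)
  then show ?thesis by simp
qed

text \<open>The Jacobi identity with two terms moved across by antisymmetry. The later computations
  with ideals, normalisers and powers of \<open>ad\<close> use it in this form.\<close>

lemma br_derivation:
  assumes [simp]: "x \<in> C" "y \<in> C" "z \<in> C"
  shows "x \<bullet> (y \<bullet> z) = (x \<bullet> y) \<bullet> z \<oplus> y \<bullet> (x \<bullet> z)"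
proof -
  have *: "y \<bullet> (z \<bullet> x) = (-1) \<odot> (y \<bullet> (x \<bullet> z))" "z \<bullet> (x \<bullet> y) = (-1) \<odot> ((x \<bullet> y) \<bullet> z)"
    using br_anti[of x z] br_anti[of "x \<bullet> y" z] by simp_all
  have "x \<bullet> (y \<bullet> z) \<oplus> (-1) \<odot> ((x \<bullet> y) \<bullet> z \<oplus> y \<bullet> (x \<bullet> z)) = \<zero>"
    using jacobi[of x y z] unfolding * by (simp add: scale_add add_ac)
  then have "x \<bullet> (y \<bullet> z) \<oplus> (-1) \<odot> ((x \<bullet> y) \<bullet> z \<oplus> y \<bullet> (x \<bullet> z)) \<oplus> ((x \<bullet> y) \<bullet> z \<oplus> y \<bullet> (x \<bullet> z))
     = (x \<bullet> y) \<bullet> z \<oplus> y \<bullet> (x \<bullet> z)" by simp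
  then show ?thesis by (subst (asm) add_assoc) simp_all
qed

subsection \<open>Subspaces and spans\<close>

lemma subspaceI:
  assumes "U \<subseteq> C" "\<zero> \<in> U" "\<And>x y. x \<in> U \<Longrightarrow> y \<in> U \<Longrightarrow> x \<oplus> y \<in> U" "\<And>c x. x \<in> U \<Longrightarrow> c \<odot> x \<in> U"
  shows "subspace L U"
  using assms by (auto simp: subspace_def)

lemma subspace_carr [simp]: "subspace L C"
  by (simp add: subspace_def)

lemma subspace_zero [simp]: "subspace L {\<zero>}"
  by (simp add: subspace_def)

lemma subspace_sub: "subspace L U \<Longrightarrow> U \<subseteq> C"
  and subspace_mem: "subspace L U \<Longrightarrow> x \<in> U \<Longrightarrow> x \<in> C"
  and subspace_0: "subspace L U \<Longrightarrow> \<zero> \<in> U"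
  and subspace_add: "subspace L U \<Longrightarrow> x \<in> U \<Longrightarrow> y \<in> U \<Longrightarrow> x \<oplus> y \<in> U"
  and subspace_scale: "subspace L U \<Longrightarrow> x \<in> U \<Longrightarrow> c \<odot> x \<in> U"
  unfolding subspace_def by auto

lemma subspace_Inter:
  assumes "\<A> \<noteq> {}" "\<And>U. U \<in> \<A> \<Longrightarrow> subspace L U"
  shows "subspace L (\<Inter>\<A>)"
proof (rule subspaceI)
  show "\<Inter>\<A> \<subseteq> C"
    using assms subspace_sub by blast
qed (use assms in \<open>auto intro: subspace_0 subspace_add subspace_scale\<close>)

lemma subspace_Int: "subspace L U \<Longrightarrow> subspace L V \<Longrightarrow> subspace L (U \<inter> V)"
  using subspace_Inter[of "{U, V}"] by auto

lemma span_subspace [simp]: "S \<subseteq> C \<Longrightarrow> subspace L (span L S)"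
  unfolding span_def by (rule subspace_Inter) (use subspace_carr in blast, blast)

lemma span_superset: "S \<subseteq> span L S"
  unfolding span_def by blast

lemma span_least: "subspace L U \<Longrightarrow> S \<subseteq> U \<Longrightarrow> span L S \<subseteq> U"
  unfolding span_def by blast

lemma span_mono: "S \<subseteq> T \<Longrightarrow> span L S \<subseteq> span L T"
  unfolding span_def by blast

lemma span_empty [simp]: "span L {} = {\<zero>}"
  using span_least[OF subspace_zero, of "{}"] subspace_0[OF span_subspace[of "{}"]] by auto

definition ssum :: "'a set \<Rightarrow> 'a set \<Rightarrow> 'a set" where
  "ssum U V = {u \<oplus> v | u v. u \<in> U \<and> v \<in> V}"

lemma ssumI: "u \<in> U \<Longrightarrow> v \<in> V \<Longrightarrow> u \<oplus> v \<in> ssum U V"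
  unfolding ssum_def by blast

lemma ssum_subspace:
  assumes U: "subspace L U" and V: "subspace L V"
  shows "subspace L (ssum U V)"
proof (rule subspaceI)
  show "ssum U V \<subseteq> C"
    using subspace_mem[OF U] subspace_mem[OF V] unfolding ssum_def by auto
  show "\<zero> \<in> ssum U V"
    using ssumI[OF subspace_0[OF U] subspace_0[OF V]] by simp
  fix x y assume "x \<in> ssum U V" "y \<in> ssum U V"
  then obtain u v u' v' where "u \<in> U" "v \<in> V" "u' \<in> U" "v' \<in> V" "x = u \<oplus> v" "y = u' \<oplus> v'"
    unfolding ssum_def by blast
  moreover from this have "x \<oplus> y = (u \<oplus> u') \<oplus> (v \<oplus> v')"
    using subspace_mem[OF U] subspace_mem[OF V] by (simp add: add_ac)
  ultimately show "x \<oplus> y \<in> ssum U V"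
    using subspace_add[OF U] subspace_add[OF V] ssumI by metis
next
  fix c x assume "x \<in> ssum U V"
  then obtain u v where "u \<in> U" "v \<in> V" "x = u \<oplus> v"
    unfolding ssum_def by blast
  then show "c \<odot> x \<in> ssum U V"
    using subspace_mem[OF U] subspace_mem[OF V] subspace_scale[OF U] subspace_scale[OF V]
    by (simp add: scale_add ssumI)
qed

lemma ssum_left: "subspace L U \<Longrightarrow> subspace L V \<Longrightarrow> U \<subseteq> ssum U V"
  by (metis add_zero ssumI subsetI subspace_0 subspace_mem)

lemma ssum_right: "subspace L U \<Longrightarrow> subspace L V \<Longrightarrow> V \<subseteq> ssum U V"
  by (metis zero_add ssumI subsetI subspace_0 subspace_mem)

lemma subspace_line: "x \<in> C \<Longrightarrow> subspace L (range (\<lambda>c. c \<odot> x))"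
proof (rule subspaceI)
  assume x: "x \<in> C"
  then show "\<zero> \<in> range (\<lambda>c. c \<odot> x)"
    by (metis rangeI zero_scale)
  show "y \<oplus> z \<in> range (\<lambda>c. c \<odot> x)" if "y \<in> range (\<lambda>c. c \<odot> x)" "z \<in> range (\<lambda>c. c \<odot> x)" for y z
    using that x by (auto simp flip: add_scale)
qed auto

lemma span_insert:
  assumes "x \<in> C" "S \<subseteq> C"
  shows "span L (insert x S) = ssum (range (\<lambda>c. c \<odot> x)) (span L S)" (is "?l = ?r")
proof
  have r: "subspace L ?r" using assms by (intro ssum_subspace subspace_line span_subspace)
  have "x \<in> range (\<lambda>c. c \<odot> x)" using assms by (metis rangeI scale_one)
  then show "?l \<subseteq> ?r"
    using ssum_left[OF subspace_line[OF assms(1)] span_subspace[OF assms(2)]]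
      ssum_right[OF subspace_line[OF assms(1)] span_subspace[OF assms(2)]] span_superset[of S]
    by (intro span_least[OF r]) blast
  have l: "subspace L ?l" using assms by simp
  show "?r \<subseteq> ?l"
    using span_superset[of "insert x S"] span_mono[of S "insert x S"]
    unfolding ssum_def by (auto intro!: subspace_add[OF l] subspace_scale[OF l])
qed

text \<open>The rank stands in for the dimension: it counts the steps of a flag of \<open>span S\<close> at which
  the intersection with \<open>U\<close> grows.\<close>

lemma rank_exists:
  assumes "finite S" "S \<subseteq> C"
  shows "\<exists>rk :: 'a set \<Rightarrow> nat. \<forall>U V. subspace L U \<longrightarrow> subspace L V \<longrightarrow> U \<subset> V \<longrightarrow> V \<subseteq> span L S \<longrightarrow> rk U < rk V"
  using assms
proof (induction S rule: finite_induct)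
  case empty
  then show ?case
    by (auto dest: subspace_0)
next
  case (insert s S)
  then obtain rk :: "'a set \<Rightarrow> nat" where
    rk: "\<And>U V. subspace L U \<Longrightarrow> subspace L V \<Longrightarrow> U \<subset> V \<Longrightarrow> V \<subseteq> span L S \<Longrightarrow> rk U < rk V"
    by (metis insert_subset)
  have sS: "s \<in> C" "S \<subseteq> C" using insert.prems by auto
  let ?W = "span L S"
  have W: "subspace L ?W" using sS by simp
  define rk' where "rk' U = rk (U \<inter> ?W) + (if U \<subseteq> ?W then 0 else 1)" for U
  have "rk' U < rk' V" if U: "subspace L U" and V: "subspace L V" and UV: "U \<subset> V" and Vs: "V \<subseteq> span L (insert s S)" for U V
  proof (cases "U \<inter> ?W = V \<inter> ?W")
    case False
    then have "rk (U \<inter> ?W) < rk (V \<inter> ?W)"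
      using UV by (intro rk subspace_Int U V W) auto
    then show ?thesis using UV unfolding rk'_def by auto
  next
    case True
    have "U \<subseteq> ?W"
    proof (rule ccontr)
      assume "\<not> U \<subseteq> ?W"
      then obtain u where u: "u \<in> U" "u \<notin> ?W" by auto
      have dec: "\<exists>c w. w \<in> ?W \<and> v = c \<odot> s \<oplus> w" if "v \<in> V" for v
        using that Vs span_insert[OF sS] unfolding ssum_def by blast
      obtain c w where cw: "w \<in> ?W" "u = c \<odot> s \<oplus> w" using dec u UV by blast
      have wC: "w \<in> C" using cw W subspace_mem by blast
      have c: "c \<noteq> 0" using u cw wC sS by auto
      have "v \<in> U" if v: "v \<in> V" for v
      proof -
        obtain d w' where dw: "w' \<in> ?W" "v = d \<odot> s \<oplus> w'" using dec v by blast
        have w'C: "w' \<in> C" using dw W subspace_mem by blast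
        \<comment> \<open>The multiple of \<open>u\<close> that cancels the
          \<open>s\<close>-component of \<open>v\<close> is added to \<open>v\<close>. The result
          lies in \<open>V\<close> and in \<open>?W\<close>, hence in \<open>U\<close> by the
          equality of intersections.\<close>
        define t where "t = (- d / c) \<odot> w \<oplus> w'"
        have tW: "t \<in> ?W" unfolding t_def using W cw dw by (simp add: subspace_add subspace_scale)
        have vt: "(- d / c) \<odot> u \<oplus> v = (- d) \<odot> s \<oplus> d \<odot> s \<oplus> t"
          unfolding cw dw t_def using c sS wC w'C by (simp add: scale_add add_ac)
        have "\<dots> = t"
          using sS tW W subspace_mem[OF W] by (simp flip: add_scale)
        with vt have vt: "(- d / c) \<odot> u \<oplus> v = t" by simp
        have uV: "u \<in> V" using u UV by auto
        have "t \<in> V"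
          unfolding vt[symmetric] using V v uV by (intro subspace_add subspace_scale)
        then have tU: "t \<in> U" using tW True by blast
        have "(d / c) \<odot> u \<oplus> t = ((d/c) \<odot> u \<oplus> (-d/c) \<odot> u) \<oplus> v"
          unfolding vt[symmetric] using subspace_mem[OF V] v uV by (simp add: add_assoc)
        also have "\<dots> = v" using subspace_mem[OF V] v uV by (simp flip: add_scale)
        finally show "v \<in> U" using U u tU by (metis subspace_add subspace_scale)
      qed
      then show False using UV by blast
    qed
    then show ?thesis using UV True unfolding rk'_def by auto
  qed
  then show ?case by (intro exI[of _ rk']) blast
qed

subsection \<open>Brackets of subspaces\<close>

lemma brspan_subspace [simp]: "A \<subseteq> C \<Longrightarrow> B \<subseteq> C \<Longrightarrow> subspace L (brspan L A B)"
  unfolding brspan_def by (rule span_subspace) (auto intro!: br_closed)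

lemma brspanI: "a \<in> A \<Longrightarrow> b \<in> B \<Longrightarrow> a \<bullet> b \<in> brspan L A B"
  unfolding brspan_def by (rule subsetD[OF span_superset]) blast

lemma brspan_least: "subspace L U \<Longrightarrow> (\<And>a b. a \<in> A \<Longrightarrow> b \<in> B \<Longrightarrow> a \<bullet> b \<in> U) \<Longrightarrow> brspan L A B \<subseteq> U"
  unfolding brspan_def by (rule span_least) auto

lemma brspan_mono: "A \<subseteq> A' \<Longrightarrow> B \<subseteq> B' \<Longrightarrow> brspan L A B \<subseteq> brspan L A' B'"
  unfolding brspan_def by (rule span_mono) auto

text \<open>Reduces claims about spans to generators: a set of generators contained in the
  transporter forces its whole span into it.\<close>

lemma subspace_left_transporter:
  assumes U: "subspace L U" and "B \<subseteq> C"
  shows "subspace L {x \<in> C. \<forall>b\<in>B. x \<bullet> b \<in> U}"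
proof -
  have "b \<in> C" if "b \<in> B" for b
    using that assms by blast
  then show ?thesis
    by (intro subspaceI)
      (auto simp: br_add_left subspace_0[OF U] intro: subspace_add[OF U] subspace_scale[OF U])
qed

lemma subspace_right_transporter:
  assumes U: "subspace L U" and "A \<subseteq> C"
  shows "subspace L {x \<in> C. \<forall>a\<in>A. a \<bullet> x \<in> U}"
proof -
  have "a \<in> C" if "a \<in> A" for a
    using that assms by blast
  then show ?thesis
    by (intro subspaceI)
      (auto simp: br_add_right subspace_0[OF U] intro: subspace_add[OF U] subspace_scale[OF U])
qed

lemma brspan_span_left:
  assumes "A \<subseteq> C" "B \<subseteq> C"
  shows "brspan L (span L A) B = brspan L A B"
proof
  have "span L A \<subseteq> {x \<in> C. \<forall>b\<in>B. x \<bullet> b \<in> brspan L A B}"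
    using assms by (intro span_least subspace_left_transporter brspan_subspace) (auto intro: brspanI)
  then show "brspan L (span L A) B \<subseteq> brspan L A B"
    using assms by (intro brspan_least brspan_subspace) auto
qed (simp add: brspan_mono span_superset)

section \<open>Powers of the adjoint maps\<close>

lemma ad_apply: "ad L x y = x \<bullet> y"
  by (simp add: ad_def)

lemma ad_pow_closed [simp]: "x \<in> C \<Longrightarrow> y \<in> C \<Longrightarrow> (ad L x ^^ n) y \<in> C"
  by (induction n) (auto simp: ad_apply)

lemma ad_pow_add: "x \<in> C \<Longrightarrow> y \<in> C \<Longrightarrow> z \<in> C \<Longrightarrow> (ad L x ^^ n) (y \<oplus> z) = (ad L x ^^ n) y \<oplus> (ad L x ^^ n) z"
  by (induction n) (auto simp: ad_apply br_add_right)

lemma ad_pow_scale: "x \<in> C \<Longrightarrow> y \<in> C \<Longrightarrow> (ad L x ^^ n) (c \<odot> y) = c \<odot> (ad L x ^^ n) y"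
  by (induction n) (auto simp: ad_apply)

lemma ad_pow_zero [simp]: "x \<in> C \<Longrightarrow> (ad L x ^^ n) \<zero> = \<zero>"
  by (induction n) (auto simp: ad_apply)

lemma ad_pow_vanish_mono:
  assumes "x \<in> C" "m \<le> n" "(ad L x ^^ m) y = \<zero>"
  shows "(ad L x ^^ n) y = \<zero>"
proof -
  have "(ad L x ^^ n) y = (ad L x ^^ (n - m)) ((ad L x ^^ m) y)"
    using assms(2) funpow_add[of "n - m" m "ad L x"] by simp
  then show ?thesis using assms by simp
qed

subsection \<open>Sets whose adjoint action generates a nilpotent associative algebra\<close>

text \<open>The span of all \<open>a1 \<bullet> (a2 \<bullet> (... (an \<bullet> y)))\<close> with
  the \<open>ai\<close> in \<open>A\<close> and \<open>y\<close> in \<open>C\<close>. It is the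
  lower central series for \<open>A = C\<close>; for smaller \<open>A\<close> it still starts at
  \<open>C\<close>, because the action on all of \<open>L\<close> matters.\<close>

definition lower :: "'a set \<Rightarrow> nat \<Rightarrow> 'a set" where
  "lower A n = (brspan L A ^^ n) C"

definition nilset :: "'a set \<Rightarrow> bool" where
  "nilset A \<longleftrightarrow> (\<exists>n. lower A n = {\<zero>})"

lemma lower_0 [simp]: "lower A 0 = C"
  and lower_Suc [simp]: "lower A (Suc n) = brspan L A (lower A n)"
  by (simp_all add: lower_def)

lemma lower_subspace [simp]:
  assumes "A \<subseteq> C"
  shows "subspace L (lower A n)"
proof (induction n)
  case (Suc n)
  then show ?case using assms subspace_sub by auto
qed simp

lemma lower_decreasing:
  assumes "A \<subseteq> C"
  shows "lower A (Suc n) \<subseteq> lower A n"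
proof (induction n)
  case 0
  have "subspace L (brspan L A C)" using assms by simp
  then show ?case using subspace_sub by simp
next
  case (Suc n)
  then show ?case by (auto intro: brspan_mono[THEN subsetD])
qed

lemma lower_mono: "A \<subseteq> B \<Longrightarrow> lower A n \<subseteq> lower B n"
  by (induction n) (auto intro: brspan_mono[THEN subsetD])

lemma lower_span:
  assumes "A \<subseteq> C"
  shows "lower (span L A) n = lower A n"
proof (induction n)
  case (Suc n)
  have "lower A n \<subseteq> C" using lower_subspace[OF assms] subspace_sub by blast
  then show ?case using assms Suc by (simp add: brspan_span_left)
qed simp

lemma nilset_span: "A \<subseteq> C \<Longrightarrow> nilset A \<Longrightarrow> nilset (span L A)"
  by (simp add: nilset_def lower_span)

lemma nilset_mono:
  assumes "nilset B" "A \<subseteq> B" "B \<subseteq> C"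
  shows "nilset A"
proof -
  obtain n where "lower B n = {\<zero>}" using assms(1) nilset_def by auto
  then have "lower A n \<subseteq> {\<zero>}" using lower_mono[OF assms(2)] by metis
  moreover have "\<zero> \<in> lower A n"
    using assms by (intro subspace_0 lower_subspace) auto
  ultimately show ?thesis unfolding nilset_def by blast
qed

lemma nilset_acts_nil:
  assumes "nilset A" "A \<subseteq> C" "x \<in> A"
  shows "acts_nil L x"
proof -
  obtain n where n: "lower A n = {\<zero>}" using assms(1) nilset_def by auto
  have "(ad L x ^^ m) y \<in> lower A m" if "y \<in> C" for m y
    by (induction m) (use that assms in \<open>auto simp: ad_apply intro: brspanI\<close>)
  with n show ?thesis unfolding acts_nil_def by blast
qed

text \<open>By induction \<open>U\<close> lies in every \<open>lower A m\<close>. In finite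
  dimension \<open>nilsetI\<close> is the converse.\<close>

lemma nilset_fixed:
  assumes "nilset A" "A \<subseteq> C" "subspace L U" "U \<subseteq> brspan L A U"
  shows "U = {\<zero>}"
proof -
  obtain n where n: "lower A n = {\<zero>}" using assms(1) nilset_def by auto
  have "U \<subseteq> lower A m" for m
  proof (induction m)
    case 0
    then show ?case using assms subspace_sub by simp
  next
    case (Suc m)
    then show ?case using assms(4) brspan_mono[of A A U "lower A m"] by auto
  qed
  with n have "U \<subseteq> {\<zero>}" by metis
  then show ?thesis using subspace_0[OF assms(3)] by auto
qed

text \<open>A form of Engel's theorem: \<open>u\<close> is a longest iterated bracket of \<open>w\<close> with elements of \<open>A\<close>
  that lies outside \<open>V\<close>.\<close>

lemma nilset_escape:
  assumes A: "nilset A" "A \<subseteq> C" and w: "w \<in> T" "w \<notin> V"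
    and T: "T \<subseteq> C" "\<And>a t. a \<in> A \<Longrightarrow> t \<in> T \<Longrightarrow> a \<bullet> t \<in> T" and V: "\<zero> \<in> V"
  shows "\<exists>u\<in>T. u \<notin> V \<and> (\<forall>a\<in>A. a \<bullet> u \<in> V)"
proof (rule ccontr)
  assume "\<not> ?thesis"
  then have *: "\<exists>a\<in>A. a \<bullet> u \<notin> V" if "u \<in> T" "u \<notin> V" for u
    using that by blast
  have "\<exists>u\<in>T. u \<notin> V \<and> u \<in> lower A n" for n
  proof (induction n)
    case 0
    then show ?case using w T by auto
  next
    case (Suc n)
    then obtain u where u: "u \<in> T" "u \<notin> V" "u \<in> lower A n" by blast
    obtain a where "a \<in> A" "a \<bullet> u \<notin> V" using * u by blast
    then show ?case using u T(2) brspanI[of a A u] by auto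
  qed
  moreover obtain n where "lower A n = {\<zero>}" using A nilset_def by auto
  ultimately show False using V by (metis singletonD)
qed

subsection \<open>Subalgebras, ideals and the Frattini ideal\<close>

lemma subalgebra_subspace: "subalgebra L S \<Longrightarrow> subspace L S"
  and subalgebra_br: "subalgebra L S \<Longrightarrow> x \<in> S \<Longrightarrow> y \<in> S \<Longrightarrow> x \<bullet> y \<in> S"
  unfolding subalgebra_def by auto

lemma subalgebra_sub: "subalgebra L S \<Longrightarrow> S \<subseteq> C"
  using subalgebra_subspace subspace_sub by blast

lemma subalgebra_carr [simp]: "subalgebra L C"
  by (simp add: subalgebra_def)

lemma subalgebra_Int: "subalgebra L S \<Longrightarrow> subalgebra L T \<Longrightarrow> subalgebra L (S \<inter> T)"
  unfolding subalgebra_def by (simp add: subspace_Int)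

lemma ideal_subspace: "ideal L I \<Longrightarrow> subspace L I"
  and ideal_br: "ideal L I \<Longrightarrow> x \<in> C \<Longrightarrow> y \<in> I \<Longrightarrow> x \<bullet> y \<in> I"
  unfolding ideal_def by auto

lemma ideal_sub: "ideal L I \<Longrightarrow> I \<subseteq> C"
  using ideal_subspace subspace_sub by blast

lemma ideal_br_left:
  assumes "ideal L I" "x \<in> I" "y \<in> C"
  shows "x \<bullet> y \<in> I"
proof -
  have "x \<in> C" using assms ideal_sub by blast
  then have "x \<bullet> y = (-1) \<odot> (y \<bullet> x)" using assms by (intro br_anti)
  then show ?thesis using assms by (simp add: ideal_br ideal_subspace subspace_scale)
qed

lemma ideal_subalgebra: "ideal L I \<Longrightarrow> subalgebra L I"
  unfolding subalgebra_def using ideal_subspace ideal_br ideal_sub by blast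

lemma ideal_carr [simp]: "ideal L C"
  by (simp add: ideal_def)

lemma ideal_ad_pow: "ideal L I \<Longrightarrow> x \<in> C \<Longrightarrow> y \<in> I \<Longrightarrow> (ad L x ^^ n) y \<in> I"
  by (induction n) (auto simp: ad_apply ideal_br)

lemma brspan_ideal:
  assumes I: "ideal L I" and J: "ideal L J"
  shows "ideal L (brspan L I J)"
proof -
  have sub: "subspace L (brspan L I J)" using I J ideal_sub by auto
  have "brspan L I J \<subseteq> {y \<in> C. \<forall>x\<in>C. x \<bullet> y \<in> brspan L I J}"
  proof (rule brspan_least)
    show "subspace L {y \<in> C. \<forall>x\<in>C. x \<bullet> y \<in> brspan L I J}"
      using sub by (intro subspace_right_transporter) auto
    fix a b assume ab: "a \<in> I" "b \<in> J"
    then have [simp]: "a \<in> C" "b \<in> C" using I J ideal_sub by auto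
    have "x \<bullet> (a \<bullet> b) \<in> brspan L I J" if x: "x \<in> C" for x
    proof -
      have "(x \<bullet> a) \<bullet> b \<in> brspan L I J" "a \<bullet> (x \<bullet> b) \<in> brspan L I J"
        using ab x I J by (auto intro!: brspanI ideal_br)
      then show ?thesis using x subspace_add[OF sub] by (simp add: br_derivation[of x a b])
    qed
    then show "a \<bullet> b \<in> {y \<in> C. \<forall>x\<in>C. x \<bullet> y \<in> brspan L I J}" by simp
  qed
  then show ?thesis unfolding ideal_def using sub by blast
qed

lemma ssum_subalgebra:
  assumes I: "ideal L I" and M: "subalgebra L M"
  shows "subalgebra L (ssum I M)"
  unfolding subalgebra_def
proof (intro conjI ballI)
  show "subspace L (ssum I M)"
    using ssum_subspace[OF ideal_subspace[OF I] subalgebra_subspace[OF M]] .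
  fix x y assume "x \<in> ssum I M" "y \<in> ssum I M"
  then obtain i m j n where x: "i \<in> I" "m \<in> M" "x = i \<oplus> m" and y: "j \<in> I" "n \<in> M" "y = j \<oplus> n"
    unfolding ssum_def by blast
  have [simp]: "i \<in> C" "j \<in> C" "m \<in> C" "n \<in> C"
    using x y ideal_sub[OF I] subalgebra_sub[OF M] by auto
  have "x \<bullet> y = i \<bullet> y \<oplus> m \<bullet> j \<oplus> m \<bullet> n"
    unfolding x y by (simp add: br_add_left br_add_right add_ac)
  moreover have "i \<bullet> y \<oplus> m \<bullet> j \<in> I"
    using x y I by (intro subspace_add[OF ideal_subspace[OF I]] ideal_br ideal_br_left) auto
  moreover have "m \<bullet> n \<in> M" using x y subalgebra_br[OF M] by blast
  ultimately show "x \<bullet> y \<in> ssum I M" using ssumI by metis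
qed

lemma gen_subalgebra:
  assumes "X \<subseteq> C"
  shows "subalgebra L (gen L X)"
proof -
  have ne: "{S. subalgebra L S \<and> X \<subseteq> S} \<noteq> {}" using assms subalgebra_carr by blast
  have "subspace L (gen L X)"
    unfolding gen_def using ne by (intro subspace_Inter) (auto simp: subalgebra_subspace)
  then show ?thesis
    unfolding subalgebra_def by (auto simp: gen_def subalgebra_br)
qed

lemma gen_superset: "X \<subseteq> gen L X"
  unfolding gen_def by blast

lemma gen_least: "subalgebra L S \<Longrightarrow> X \<subseteq> S \<Longrightarrow> gen L X \<subseteq> S"
  unfolding gen_def by blast

text \<open>The \<open>THE\<close> in the definition says nothing until a greatest ideal is
  exhibited; it is the span of the union of all admissible ideals. Without maximal subalgebras the
  intersection is \<open>UNIV\<close>, and the ideal is \<open>C\<close>.\<close>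

lemma frattini:
  shows frattini_ideal: "ideal L (frattini L)"
    and frattini_sub: "max_subalg L M \<Longrightarrow> frattini L \<subseteq> M"
    and frattini_greatest: "ideal L J \<Longrightarrow> (\<And>M. max_subalg L M \<Longrightarrow> J \<subseteq> M) \<Longrightarrow> J \<subseteq> frattini L"
proof -
  let ?P = "\<lambda>I. ideal L I \<and> I \<subseteq> \<Inter>{M. max_subalg L M}"
  let ?Q = "\<lambda>I. ideal L I \<and> I \<subseteq> \<Inter>{M. max_subalg L M} \<and> (\<forall>J. ?P J \<longrightarrow> J \<subseteq> I)"
  define U where "U = \<Union>{I. ?P I}"
  have UC: "U \<subseteq> C" unfolding U_def using ideal_sub by blast
  have "span L U \<subseteq> {y \<in> C. \<forall>x\<in>C. x \<bullet> y \<in> span L U}"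
  proof (intro span_least subspace_right_transporter span_subspace UC)
    show "U \<subseteq> {y \<in> C. \<forall>x\<in>C. x \<bullet> y \<in> span L U}"
      using UC ideal_br span_superset[of U] unfolding U_def by blast
  qed auto
  then have "ideal L (span L U)"
    unfolding ideal_def using span_subspace[OF UC] by blast
  moreover have "span L U \<subseteq> M" if "max_subalg L M" for M
    using that by (intro span_least subalgebra_subspace) (auto simp: max_subalg_def U_def)
  moreover have "J \<subseteq> span L U" if "?P J" for J
    using that span_superset[of U] unfolding U_def by blast
  ultimately have Q: "?Q (span L U)" by blast
  have "frattini L = span L U"
    unfolding frattini_def
  proof (rule the_equality)
    show "I = span L U" if "?Q I" for I using Q that by (metis subset_antisym)
  qed (rule Q)
  then have *: "?Q (frattini L)" using Q by simp
  show "ideal L (frattini L)" using * by blast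
  show "max_subalg L M \<Longrightarrow> frattini L \<subseteq> M" using * by blast
  show "ideal L J \<Longrightarrow> (\<And>M. max_subalg L M \<Longrightarrow> J \<subseteq> M) \<Longrightarrow> J \<subseteq> frattini L" using * by blast
qed

lemma normalizer_subalgebra:
  assumes K: "subspace L K"
  shows "subalgebra L (normalizer L K)"
  unfolding subalgebra_def
proof (intro conjI ballI)
  have KC: "K \<subseteq> C" using subspace_sub[OF K] .
  then show "subspace L (normalizer L K)"
    unfolding normalizer_def using subspace_left_transporter[OF K] by blast
  fix x y assume xy: "x \<in> normalizer L K" "y \<in> normalizer L K"
  have [simp]: "x \<in> C" "y \<in> C" using xy unfolding normalizer_def by auto
  have "(x \<bullet> y) \<bullet> k \<in> K" if k: "k \<in> K" for k
  proof -
    have [simp]: "k \<in> C" using k KC by blast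
    have "x \<bullet> (y \<bullet> k) \<oplus> (-1) \<odot> (y \<bullet> (x \<bullet> k)) = (x \<bullet> y) \<bullet> k"
      by (simp add: br_derivation[of x y k] add_assoc)
    moreover have "x \<bullet> (y \<bullet> k) \<in> K" "y \<bullet> (x \<bullet> k) \<in> K"
      using xy k unfolding normalizer_def by auto
    ultimately show ?thesis using subspace_add[OF K] subspace_scale[OF K] by metis
  qed
  then show "x \<bullet> y \<in> normalizer L K" unfolding normalizer_def by simp
qed

lemma normalizer_superset: "subalgebra L K \<Longrightarrow> K \<subseteq> normalizer L K"
  unfolding normalizer_def using subalgebra_br subalgebra_sub by blast

section \<open>Leibniz rule and perturbation for powers of \<open>ad\<close>\<close>

text \<open>In the Leibniz expansion each term hits \<open>y\<close> at least \<open>a\<close> times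
  or \<open>z\<close> at least \<open>b\<close> times. Splitting off one \<open>ad L x\<close> per
  induction step avoids binomial coefficients. This makes the Fitting null component a
  subalgebra.\<close>

lemma ad_pow_bracket_vanish:
  assumes "x \<in> C" "y \<in> C" "z \<in> C" "(ad L x ^^ a) y = \<zero>" "(ad L x ^^ b) z = \<zero>"
  shows "(ad L x ^^ (a + b)) (y \<bullet> z) = \<zero>"
  using assms
proof (induction "a + b" arbitrary: a b y z)
  case 0
  then show ?case by simp
next
  case (Suc n)
  note [simp] = Suc.prems(1-3)
  show ?case
  proof (cases "a = 0 \<or> b = 0")
    case True
    then show ?thesis using Suc.prems by auto
  next
    case False
    then obtain a' b' where ab: "a = Suc a'" "b = Suc b'" by (meson not0_implies_Suc)
    have n: "n = a' + b" "n = a + b'" using Suc.hyps(2) ab by auto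
    have shift: "(ad L x ^^ Suc k) u = (ad L x ^^ k) (x \<bullet> u)" for k u
      by (simp add: funpow_swap1 ad_apply)
    have xy: "x \<bullet> y \<in> C" "x \<bullet> z \<in> C" by simp_all
    have "(ad L x ^^ a') (x \<bullet> y) = \<zero>" "(ad L x ^^ b') (x \<bullet> z) = \<zero>"
      using Suc.prems(4,5) unfolding ab shift .
    note * = Suc.hyps(1)[OF n(1) Suc.prems(1) xy(1) Suc.prems(3) this(1) Suc.prems(5)]
      Suc.hyps(1)[OF n(2) Suc.prems(1,2) xy(2) Suc.prems(4) this(2)]
    have "(ad L x ^^ n) ((x \<bullet> y) \<bullet> z) = \<zero>" "(ad L x ^^ n) (y \<bullet> (x \<bullet> z)) = \<zero>"
      using *[folded n] .
    then have "(ad L x ^^ n) (x \<bullet> (y \<bullet> z)) = \<zero>"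
      by (simp add: br_derivation[of x y z] ad_pow_add)
    then show ?thesis
      unfolding Suc.hyps(2)[symmetric] shift .
  qed
qed

text \<open>On \<open>T\<close> the summand \<open>i\<close> acts as zero modulo the ideal
  \<open>J\<close>, so \<open>i \<oplus> m\<close> acts there like \<open>m\<close>. The two uses
  are \<open>T = C\<close> modulo an ideal \<open>I\<close>, and \<open>T = I\<close> modulo
  \<open>frattini L\<close>.\<close>

lemma ad_pow_perturb:
  assumes J: "ideal L J" and T: "T \<subseteq> C" and im: "i \<in> C" "m \<in> C"
    and inv: "\<And>t. t \<in> T \<Longrightarrow> m \<bullet> t \<in> T" "\<And>t. t \<in> T \<Longrightarrow> i \<bullet> t \<in> J" and t: "t \<in> T"
  shows "\<exists>j\<in>J. (ad L (i \<oplus> m) ^^ n) t = j \<oplus> (ad L m ^^ n) t"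
proof (induction n)
  case 0
  then show ?case using subspace_0[OF ideal_subspace[OF J]] t T by (auto intro!: bexI[of _ \<zero>])
next
  case (Suc n)
  then obtain j where j: "j \<in> J" "(ad L (i \<oplus> m) ^^ n) t = j \<oplus> (ad L m ^^ n) t" by blast
  have mT: "(ad L m ^^ n) t \<in> T" by (induction n) (auto simp: t ad_apply inv)
  then have [simp]: "(ad L m ^^ n) t \<in> C" "j \<in> C" using T j ideal_sub[OF J] by auto
  have "(ad L (i \<oplus> m) ^^ Suc n) t = ((i \<oplus> m) \<bullet> j \<oplus> i \<bullet> (ad L m ^^ n) t) \<oplus> (ad L m ^^ Suc n) t"
    using im by (simp add: ad_apply j(2) br_add_left br_add_right add_ac)
  moreover have "(i \<oplus> m) \<bullet> j \<oplus> i \<bullet> (ad L m ^^ n) t \<in> J"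
    using subspace_add[OF ideal_subspace[OF J] ideal_br[OF J _ j(1)] inv(2)[OF mT]] im by simp
  ultimately show ?case by blast
qed

end

subsection \<open>Finite dimension and Jacobson's theorem\<close>

locale fd_lie = lie L for L :: "('k::field, 'a) lie_alg" +
  assumes fin_dim: "fin_dim L"
begin

text \<open>Only strict monotonicity is ever needed of a dimension, so any such function is chosen,
  free of a reference to a spanning set.\<close>

definition rk :: "'a set \<Rightarrow> nat" where
  "rk = (SOME r. \<forall>U V. subspace L U \<longrightarrow> subspace L V \<longrightarrow> U \<subset> V \<longrightarrow> r U < r V)"

lemma rk_less:
  assumes "subspace L U" "subspace L V" "U \<subset> V"
  shows "rk U < rk V"
proof -
  obtain S where S: "finite S" "S \<subseteq> C" "span L S = C"
    using fin_dim unfolding fin_dim_def by blast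
  have "\<exists>r :: 'a set \<Rightarrow> nat. \<forall>U V. subspace L U \<longrightarrow> subspace L V \<longrightarrow> U \<subset> V \<longrightarrow> r U < r V"
    using rank_exists[OF S(1,2)] S(3) subspace_sub by metis
  from someI_ex[OF this] show ?thesis
    using assms unfolding rk_def[symmetric] by blast
qed

lemma rk_le:
  assumes "subspace L U" "subspace L V" "U \<subseteq> V"
  shows "rk U \<le> rk V"
  using rk_less[OF assms(1,2)] assms(3) by (cases "U = V") (auto simp: psubset_eq)

lemma maximal_subspace_exists:
  assumes "P U0" and sub: "\<And>U. P U \<Longrightarrow> subspace L U"
  obtains U where "P U" "U0 \<subseteq> U" "\<And>V. P V \<Longrightarrow> U \<subseteq> V \<Longrightarrow> V = U"
proof -
  let ?Q = "\<lambda>U. P U \<and> U0 \<subseteq> U"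
  have "rk U \<le> rk C" if "?Q U" for U
    using that rk_le sub subspace_sub subspace_carr by metis
  then have "\<exists>U. ?Q U \<and> (\<forall>V. ?Q V \<longrightarrow> rk V \<le> rk U)"
    using assms(1) by (intro ex_has_greatest_nat[of ?Q U0 rk "Suc (rk C)"]) (auto simp: less_Suc_eq_le)
  then obtain U where U: "?Q U" "\<And>V. ?Q V \<Longrightarrow> rk V \<le> rk U" by blast
  have "V = U" if "P V" "U \<subseteq> V" for V
  proof (rule ccontr)
    assume "V \<noteq> U"
    then have "rk U < rk V" using that U sub by (intro rk_less) auto
    moreover have "rk V \<le> rk U" using that U by blast
    ultimately show False by simp
  qed
  then show thesis using that U by blast
qed

lemma minimal_subspace_exists:
  assumes "P U0" and sub: "\<And>U. P U \<Longrightarrow> subspace L U"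
  obtains U where "P U" "U \<subseteq> U0" "\<And>V. P V \<Longrightarrow> V \<subseteq> U \<Longrightarrow> V = U"
proof -
  let ?Q = "\<lambda>U. P U \<and> U \<subseteq> U0"
  have "\<exists>U. ?Q U \<and> (\<forall>V. ?Q V \<longrightarrow> rk U \<le> rk V)"
    using assms(1) by (intro ex_has_least_nat[of ?Q U0 rk]) auto
  then obtain U where U: "?Q U" "\<And>V. ?Q V \<Longrightarrow> rk U \<le> rk V" by blast
  have "V = U" if "P V" "V \<subseteq> U" for V
  proof (rule ccontr)
    assume "V \<noteq> U"
    then have "rk V < rk U" using that U sub by (intro rk_less) auto
    moreover have "rk U \<le> rk V" using that U by blast
    ultimately show False by simp
  qed
  then show thesis using that U by blast
qed

text \<open>A minimal member of the family equals its successor. One equality is enough for the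
  sequences considered, since each of their terms is determined by the previous one.\<close>

lemma decreasing_stabilises:
  assumes "\<And>n :: nat. subspace L (f n)" "\<And>n. f (Suc n) \<subseteq> f n"
  obtains n where "f (Suc n) = f n"
proof -
  define P where "P U \<longleftrightarrow> (\<exists>n. U = f n)" for U
  have f0: "P (f 0)" and fs: "\<And>U. P U \<Longrightarrow> subspace L U"
    using assms(1) unfolding P_def by auto
  from minimal_subspace_exists[of P, OF f0 fs]
  obtain U where U: "P U" "\<And>V. P V \<Longrightarrow> V \<subseteq> U \<Longrightarrow> V = U" by metis
  then obtain n where "U = f n" unfolding P_def by blast
  then show thesis using that U(2)[of "f (Suc n)"] assms(2) unfolding P_def by blast
qed

lemma increasing_stabilises:
  assumes "\<And>n :: nat. subspace L (f n)" "\<And>n. f n \<subseteq> f (Suc n)"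
  obtains n where "\<forall>m. f m \<subseteq> f n"
proof -
  define P where "P U \<longleftrightarrow> (\<exists>n. U = f n)" for U
  have f0: "P (f 0)" and fs: "\<And>U. P U \<Longrightarrow> subspace L U"
    using assms(1) unfolding P_def by auto
  from maximal_subspace_exists[of P, OF f0 fs]
  obtain U where U: "P U" "\<And>V. P V \<Longrightarrow> U \<subseteq> V \<Longrightarrow> V = U" by metis
  then obtain n where n: "U = f n" unfolding P_def by blast
  have "f m \<subseteq> f n" for m
  proof -
    have "f n \<subseteq> f (max m n)" "f m \<subseteq> f (max m n)"
      using lift_Suc_mono_le[of f, OF assms(2)] by auto
    moreover have "f (max m n) = U"
      using U(2) calculation(1) n unfolding P_def by blast
    ultimately show ?thesis using n by simp
  qed
  then show thesis using that by blast
qed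

text \<open>The descending sequence \<open>lower A\<close> stops at a subspace fixed by
  \<open>brspan L A\<close>.\<close>

lemma nilsetI:
  assumes A: "A \<subseteq> C" and fixed: "\<And>U. subspace L U \<Longrightarrow> brspan L A U = U \<Longrightarrow> U = {\<zero>}"
  shows "nilset A"
proof -
  obtain n where "lower A (Suc n) = lower A n"
    using decreasing_stabilises[of "lower A", OF lower_subspace[OF A] lower_decreasing[OF A]] .
  then have "lower A n = {\<zero>}" using fixed lower_subspace[OF A] by simp
  then show ?thesis unfolding nilset_def by blast
qed

text \<open>For a fixed subspace \<open>U\<close> put \<open>X = brspan L D U\<close>. Since
  \<open>w\<close> normalises the span of \<open>D\<close>, it maps \<open>X\<close> to itself, and
  \<open>U\<close> is the sum of \<open>X\<close> and the image of \<open>U\<close> under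
  \<open>ad L w\<close>. Iterating until the power of \<open>ad L w\<close> vanishes gives
  \<open>U \<subseteq> X\<close>, and then \<open>nilset D\<close> kills \<open>U\<close>.\<close>

lemma nilset_insert:
  assumes D: "D \<subseteq> C" "nilset D" and w: "w \<in> C" "acts_nil L w"
    and norm: "\<And>d. d \<in> D \<Longrightarrow> w \<bullet> d \<in> span L D"
  shows "nilset (insert w D)"
proof (rule nilsetI)
  show "insert w D \<subseteq> C" using D w by auto
  fix U assume U: "subspace L U" and eq: "brspan L (insert w D) U = U"
  note UC = subspace_mem[OF U]
  define X where "X = brspan L D U"
  have X: "subspace L X" unfolding X_def using D U subspace_sub by simp
  note XC = subspace_mem[OF X]
  have wU: "w \<bullet> u \<in> U" if "u \<in> U" for u
    using brspanI[of w "insert w D" u U] that eq by auto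
  have "X \<subseteq> {x \<in> C. \<forall>a\<in>{w}. a \<bullet> x \<in> X}"
    unfolding X_def
  proof (rule brspan_least)
    show "subspace L {x \<in> C. \<forall>a\<in>{w}. a \<bullet> x \<in> brspan L D U}"
      using X w unfolding X_def by (intro subspace_right_transporter) auto
    fix d u assume du: "d \<in> D" "u \<in> U"
    have [simp]: "d \<in> C" "u \<in> C" "w \<in> C" using du D UC w by auto
    \<comment> \<open>The bracket of \<open>w\<close> and \<open>d\<close> is known to lie only in
      the span of \<open>D\<close>, but \<open>D\<close> and its span give the same
      \<open>X\<close>.\<close>
    have "(w \<bullet> d) \<bullet> u \<in> brspan L (span L D) U"
      using du norm by (intro brspanI) auto
    then have "(w \<bullet> d) \<bullet> u \<in> X"
      unfolding X_def using D U by (simp add: brspan_span_left subspace_sub)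
    moreover have "d \<bullet> (w \<bullet> u) \<in> X"
      unfolding X_def using du wU by (intro brspanI) auto
    ultimately show "d \<bullet> u \<in> {x \<in> C. \<forall>a\<in>{w}. a \<bullet> x \<in> brspan L D U}"
      using subspace_add[OF X] unfolding X_def by (simp add: br_derivation[of w d u])
  qed
  then have wX: "w \<bullet> x \<in> X" if "x \<in> X" for x using that by blast
  let ?Y = "{w \<bullet> u | u. u \<in> U}"
  have Y: "subspace L ?Y"
  proof (rule subspaceI)
    show "?Y \<subseteq> C" using w UC by auto
    show "\<zero> \<in> ?Y" using subspace_0[OF U] br_zero[OF w(1)] by force
    show "x \<oplus> y \<in> ?Y" if "x \<in> ?Y" "y \<in> ?Y" for x y
      using that subspace_add[OF U] UC w(1) by (auto simp flip: br_add_right)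
    show "c \<odot> x \<in> ?Y" if "x \<in> ?Y" for c x
      using that subspace_scale[OF U] UC w(1) by (auto simp flip: br_scale_right)
  qed
  have "brspan L (insert w D) U \<subseteq> ssum X ?Y"
  proof (rule brspan_least)
    show "subspace L (ssum X ?Y)" using X Y by (rule ssum_subspace)
    fix a u assume "a \<in> insert w D" "u \<in> U"
    then show "a \<bullet> u \<in> ssum X ?Y"
      using ssum_left[OF X Y] ssum_right[OF X Y] brspanI[of a D u U] unfolding X_def by blast
  qed
  then have dec: "\<exists>x\<in>X. \<exists>v\<in>U. u = x \<oplus> w \<bullet> v" if "u \<in> U" for u
    using that eq unfolding ssum_def by blast
  have "\<exists>x\<in>X. \<exists>v\<in>U. u = x \<oplus> (ad L w ^^ n) v" if "u \<in> U" for u n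
    using that
  proof (induction n arbitrary: u)
    case 0
    then show ?case using subspace_0[OF X] UC by (metis funpow_0 zero_add)
  next
    case (Suc n)
    obtain x v where x: "x \<in> X" "v \<in> U" "u = x \<oplus> w \<bullet> v" using dec Suc.prems by blast
    obtain y z where y: "y \<in> X" "z \<in> U" "v = y \<oplus> (ad L w ^^ n) z" using Suc.IH x by blast
    have "u = (x \<oplus> w \<bullet> y) \<oplus> (ad L w ^^ Suc n) z"
      using x y XC UC w by (simp add: br_add_right add_assoc ad_apply)
    moreover have "x \<oplus> w \<bullet> y \<in> X" using x y wX subspace_add[OF X] by blast
    ultimately show ?case using y by blast
  qed
  moreover obtain n where "\<forall>y\<in>C. (ad L w ^^ n) y = \<zero>"
    using w(2) unfolding acts_nil_def by blast
  ultimately have "U \<subseteq> X"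
    using UC XC by (metis add_zero subsetI)
  then show "U = {\<zero>}"
    using nilset_fixed[OF D(2,1) U] unfolding X_def by blast
qed

text \<open>Jacobson's theorem on weakly closed sets of nilpotent transformations, for sets closed
  under the bracket. A maximal span of a nilpotent bracket-closed subset is enlarged by
  an element normalising it.\<close>

theorem bracket_closed_nilset:
  assumes W: "W \<subseteq> C" "\<And>x y. x \<in> W \<Longrightarrow> y \<in> W \<Longrightarrow> x \<bullet> y \<in> W" "\<And>x. x \<in> W \<Longrightarrow> acts_nil L x"
  shows "nilset W"
proof -
  define P where "P U \<longleftrightarrow> (\<exists>D\<subseteq>W. (\<forall>x\<in>D. \<forall>y\<in>D. x \<bullet> y \<in> D) \<and> nilset D \<and> U = span L D)" for U
  have "nilset {}"
    \<comment> \<open>One step is required: \<open>lower {} 0\<close> is still \<open>C\<close>, and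
      the span of no brackets is zero.\<close>
    unfolding nilset_def by (rule exI[of _ "Suc 0"]) (simp add: brspan_def)
  then have "P (span L {})" unfolding P_def by blast
  moreover have "subspace L U" if "P U" for U using that W(1) unfolding P_def by auto
  ultimately obtain U where U: "P U" and max: "\<And>V. P V \<Longrightarrow> U \<subseteq> V \<Longrightarrow> V = U"
    using maximal_subspace_exists[of P] by metis
  obtain D where D: "D \<subseteq> W" "\<forall>x\<in>D. \<forall>y\<in>D. x \<bullet> y \<in> D" "nilset D" "U = span L D"
    using U unfolding P_def by blast
  have Us: "subspace L U" and UC: "U \<subseteq> C" and DC: "D \<subseteq> C"
    using D W(1) subspace_sub[OF span_subspace[of D]] by auto
  have nU: "nilset U" using nilset_span[OF DC D(3)] D(4) by simp
  have Ubr: "x \<bullet> y \<in> U" if "x \<in> U" "y \<in> U" for x y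
  proof -
    \<comment> \<open>Closure is extended from \<open>D\<close> to its span in the right argument
      first, then in the left one.\<close>
    have "D \<subseteq> {x \<in> C. \<forall>a\<in>D. a \<bullet> x \<in> U}"
      using DC D(2,4) span_superset by blast
    then have "U \<subseteq> {x \<in> C. \<forall>a\<in>D. a \<bullet> x \<in> U}"
      unfolding D(4) using DC by (intro span_least subspace_right_transporter) auto
    then have "D \<subseteq> {x \<in> C. \<forall>b\<in>U. x \<bullet> b \<in> U}"
      using DC by blast
    then have "U \<subseteq> {x \<in> C. \<forall>b\<in>U. x \<bullet> b \<in> U}"
      using span_least[OF subspace_left_transporter[OF Us UC]] unfolding D(4) by blast
    then show ?thesis using that by blast
  qed
  have "W \<subseteq> U"
  proof (rule ccontr)
    assume "\<not> W \<subseteq> U"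
    then obtain w where w: "w \<in> W" "w \<notin> U" by blast
    \<comment> \<open>Passing from \<open>D\<close> to all of \<open>W \<inter> U\<close> keeps the
      span and makes the enlarged set closed: brackets of \<open>v\<close> with its elements lie in
      \<open>W\<close> and in \<open>U\<close>.\<close>
    let ?D = "W \<inter> U"
    have nD: "nilset ?D" using nilset_mono[OF nU _ UC] by blast
    have DC': "?D \<subseteq> C" using W(1) by blast
    have cl: "\<And>a t. a \<in> ?D \<Longrightarrow> t \<in> W \<Longrightarrow> a \<bullet> t \<in> W" using W(2) by blast
    obtain v where v: "v \<in> W" "v \<notin> U" "\<And>a. a \<in> ?D \<Longrightarrow> a \<bullet> v \<in> U"
      using nilset_escape[OF nD DC' w W(1) cl subspace_0[OF Us]] by blast
    have sD: "span L ?D = U"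
      using span_least[OF Us, of ?D] span_mono[of D ?D] D(1,4) span_superset[of D] by blast
    have vC: "v \<in> C" using v W by blast
    have va: "v \<bullet> a \<in> U" if a: "a \<in> ?D" for a
    proof -
      have "v \<bullet> a = (-1) \<odot> (a \<bullet> v)"
        using a W(1) vC by (intro br_anti) auto
      then show ?thesis using subspace_scale[OF Us v(3)[OF a]] by simp
    qed
    have "nilset (insert v ?D)"
      using v W va sD by (intro nilset_insert DC' nD) auto
    moreover have "\<forall>x\<in>insert v ?D. \<forall>y\<in>insert v ?D. x \<bullet> y \<in> insert v ?D"
    proof (intro ballI)
      fix x y assume xy: "x \<in> insert v ?D" "y \<in> insert v ?D"
      then have "x \<bullet> y \<in> W" using v W by blast
      moreover have "x \<bullet> y \<in> U"
        using xy v(3) va Ubr vC subspace_0[OF Us] by auto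
      ultimately show "x \<bullet> y \<in> insert v ?D" by blast
    qed
    ultimately have "P (span L (insert v ?D))" unfolding P_def using v(1) by (intro exI[of _ "insert v ?D"]) simp
    moreover have "U \<subseteq> span L (insert v ?D)" using span_mono[of ?D "insert v ?D"] sD by blast
    ultimately have "span L (insert v ?D) = U" using max by blast
    then show False using v span_superset[of "insert v ?D"] by blast
  qed
  then show ?thesis using nilset_mono[OF nU _ UC] by blast
qed

lemma span_acts_nil:
  assumes "W \<subseteq> C" "\<And>x y. x \<in> W \<Longrightarrow> y \<in> W \<Longrightarrow> x \<bullet> y \<in> W" "\<And>x. x \<in> W \<Longrightarrow> acts_nil L x"
    and "x \<in> span L W"
  shows "acts_nil L x"
  using nilset_acts_nil[OF nilset_span[OF assms(1) bracket_closed_nilset[OF assms(1-3)]]] assms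
  by (meson span_subspace subspace_sub)

subsection \<open>Triangulable subalgebras\<close>

text \<open>Brackets of elements of \<open>S\<close> lie in \<open>S\<close>, so the bracket of two
  such brackets is again one. The set of all brackets thus satisfies the hypotheses of Jacobson's
  theorem, and its span is \<open>brspan L S S\<close>.\<close>

lemma triang_onI:
  assumes S: "subalgebra L S" and "\<And>x y. x \<in> S \<Longrightarrow> y \<in> S \<Longrightarrow> acts_nil L (x \<bullet> y)"
  shows "triang_on L S"
proof -
  let ?W = "{x \<bullet> y | x y. x \<in> S \<and> y \<in> S}"
  have W: "?W \<subseteq> S" using subalgebra_br[OF S] by blast
  have "acts_nil L x" if "x \<in> span L ?W" for x
  proof (rule span_acts_nil[OF _ _ _ that])
    show "?W \<subseteq> C" using W subalgebra_sub[OF S] by blast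
  qed (use W assms(2) in blast)+
  then show ?thesis unfolding triang_on_def brspan_def by blast
qed

text \<open>By \<open>triang_onI\<close> single brackets suffice, and each belongs to the derived
  algebra of the subalgebra generated by its two arguments.\<close>

lemma triang_on_if_two_gen:
  assumes S: "subalgebra L S"
    and *: "\<And>T. subalgebra L T \<Longrightarrow> T \<subseteq> S \<Longrightarrow> two_gen L T \<Longrightarrow> triang_on L T"
  shows "triang_on L S"
proof (rule triang_onI[OF S])
  fix x y assume xy: "x \<in> S" "y \<in> S"
  let ?T = "gen L {x, y}"
  have "{x, y} \<subseteq> C" using xy subalgebra_sub[OF S] by blast
  then have "subalgebra L ?T" by (rule gen_subalgebra)
  moreover have "?T \<subseteq> S" using S xy by (intro gen_least) auto
  moreover have T: "x \<in> ?T" "y \<in> ?T" using gen_superset[of "{x, y}"] by auto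
  then have "two_gen L ?T" unfolding two_gen_def by blast
  ultimately have "triang_on L ?T" using * by blast
  then show "acts_nil L (x \<bullet> y)" unfolding triang_on_def using T brspanI by blast
qed

text \<open>Every bracket in \<open>S\<close> acts nilpotently, so closure under brackets with
  \<open>S\<close> is immediate. Closure under sums is the real content and comes from
  \<open>span_acts_nil\<close>.\<close>

lemma nil_elements_ideal:
  assumes S: "subalgebra L S" and tr: "triang_on L S"
  shows "ideal_of L S {x \<in> S. acts_nil L x}"
proof -
  let ?N = "{x \<in> S. acts_nil L x}" and ?D = "brspan L S S"
  note SC = subalgebra_sub[OF S]
  have D: "?D \<subseteq> S" using S subalgebra_br[OF S] by (intro brspan_least subalgebra_subspace) auto
  have Dnil: "acts_nil L x" if "x \<in> ?D" for x using tr that unfolding triang_on_def by blast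
  have NC: "?N \<subseteq> C" using SC by blast
  have br: "x \<bullet> y \<in> ?N" if "x \<in> S" "y \<in> S" for x y
    using that Dnil brspanI[of x S y S] subalgebra_br[OF S] by blast
  have "span L ?N \<subseteq> ?N"
  proof
    fix x assume x: "x \<in> span L ?N"
    then have "x \<in> S" using span_least[OF subalgebra_subspace[OF S], of ?N] by blast
    moreover have "acts_nil L x"
      using span_acts_nil[OF NC _ _ x] br by blast
    ultimately show "x \<in> ?N" by blast
  qed
  then have "span L ?N = ?N" by (rule subset_antisym) (rule span_superset)
  then have "subspace L ?N" using span_subspace[OF NC] by simp
  then show ?thesis unfolding ideal_of_def using br by blast
qed

lemma nil_eq:
  assumes "subalgebra L S" "triang_on L S"
  shows "nil L S = {x \<in> S. acts_nil L x}"
  unfolding nil_def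
proof (rule the_equality)
  show *: "ideal_of L S {x \<in> S. acts_nil L x} \<and> (\<forall>x\<in>{x \<in> S. acts_nil L x}. acts_nil L x) \<and>
    (\<forall>J. ideal_of L S J \<and> (\<forall>x\<in>J. acts_nil L x) \<longrightarrow> J \<subseteq> {x \<in> S. acts_nil L x})"
    using nil_elements_ideal[OF assms] by (auto simp: ideal_of_def)
  fix I assume "ideal_of L S I \<and> (\<forall>x\<in>I. acts_nil L x) \<and>
    (\<forall>J. ideal_of L S J \<and> (\<forall>x\<in>J. acts_nil L x) \<longrightarrow> J \<subseteq> I)"
  with * show "I = {x \<in> S. acts_nil L x}" by (metis subset_antisym)
qed

lemma max_subalg_exists:
  assumes "subalgebra L S" "S \<noteq> C"
  obtains M where "max_subalg L M" "S \<subseteq> M"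
proof -
  define P where "P T \<longleftrightarrow> subalgebra L T \<and> T \<noteq> C" for T
  have "P S" "\<And>T. P T \<Longrightarrow> subspace L T"
    using assms subalgebra_subspace unfolding P_def by auto
  from maximal_subspace_exists[of P, OF this]
  obtain M where M: "P M" "S \<subseteq> M" "\<And>V. P V \<Longrightarrow> M \<subseteq> V \<Longrightarrow> V = M" by metis
  then have "max_subalg L M" unfolding max_subalg_def P_def by blast
  then show thesis using that M by blast
qed

text \<open>Fitting decomposition: the Fitting null component of \<open>x\<close> is a subalgebra which together
  with the Frattini ideal spans \<open>L\<close>, so it is \<open>L\<close>.\<close>

lemma acts_nil_if_nil_mod_frattini:
  assumes x: "x \<in> C" and n: "\<And>y. y \<in> C \<Longrightarrow> (ad L x ^^ n) y \<in> frattini L"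
  shows "acts_nil L x"
proof -
  define f where "f k = (ad L x ^^ k) ` C" for k
  have fs: "subspace L (f k)" for k
  proof (rule subspaceI)
    show "f k \<subseteq> C" unfolding f_def using x by auto
    show "\<zero> \<in> f k" unfolding f_def using ad_pow_zero[OF x, of k] by (metis imageI zero_closed)
    show "u \<oplus> v \<in> f k" if "u \<in> f k" "v \<in> f k" for u v
      using that x unfolding f_def by (auto simp flip: ad_pow_add)
    show "c \<odot> u \<in> f k" if "u \<in> f k" for c u
      using that x unfolding f_def by (auto simp flip: ad_pow_scale)
  qed
  have fS: "f (Suc k) = ad L x ` f k" for k unfolding f_def by (auto simp: image_iff)
  have fd: "f (Suc k) \<subseteq> f k" for k
    unfolding f_def using x by (auto simp: funpow_swap1 ad_apply)
  obtain N where N: "f (Suc N) = f N" using decreasing_stabilises[of f, OF fs fd] .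
  have stab: "f (N + m) = f N" for m
    by (induction m) (use N fS in auto)
  \<comment> \<open>At least \<open>N\<close>, so that the images are stationary and
    \<open>f m = f (m + m)\<close>; at least \<open>n\<close>, so that the values lie in
    \<open>frattini L\<close>.\<close>
  define m where "m = N + n"
  define K where "K = {y \<in> C. \<exists>k. (ad L x ^^ k) y = \<zero>}"
  have dec: "\<exists>d\<in>K. \<exists>e\<in>frattini L. y = d \<oplus> e" if y: "y \<in> C" for y
  proof -
    have "(ad L x ^^ m) y \<in> f m" using y unfolding f_def by blast
    also have "f m = f (m + m)"
      using stab[of n] stab[of "n + m"] unfolding m_def by (simp add: add.assoc)
    finally obtain z where z: "z \<in> C" "(ad L x ^^ m) y = (ad L x ^^ m) ((ad L x ^^ m) z)"
      unfolding f_def by (auto simp: funpow_add)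
    \<comment> \<open>The Fitting decomposition of \<open>y\<close>: \<open>?e\<close> has the same
      image as \<open>y\<close> under the \<open>m\<close>-th power, so their difference is in the
      null component.\<close>
    let ?e = "(ad L x ^^ m) z"
    have e: "?e \<in> frattini L"
      using ideal_ad_pow[OF frattini_ideal x n[OF z(1)]] unfolding m_def by (simp add: funpow_add)
    have eC: "?e \<in> C" using x z by simp
    have "(ad L x ^^ m) (y \<oplus> (-1) \<odot> ?e) = \<zero>"
      using x y eC z(2) by (simp add: ad_pow_add ad_pow_scale)
    then have "y \<oplus> (-1) \<odot> ?e \<in> K" using y eC unfolding K_def by auto
    moreover have "y = (y \<oplus> (-1) \<odot> ?e) \<oplus> ?e" using y eC by (simp add: add_assoc)
    ultimately show ?thesis using e by blast
  qed
  have "subalgebra L K"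
    unfolding subalgebra_def
  proof (intro conjI ballI subspaceI)
    fix u v assume "u \<in> K" "v \<in> K"
    then obtain a b where ab: "u \<in> C" "v \<in> C" "(ad L x ^^ a) u = \<zero>" "(ad L x ^^ b) v = \<zero>"
      unfolding K_def by blast
    have "(ad L x ^^ (a + b)) u = \<zero>" "(ad L x ^^ (a + b)) v = \<zero>"
      using ad_pow_vanish_mono[OF x _ ab(3), of "a + b"] ad_pow_vanish_mono[OF x _ ab(4), of "a + b"]
      by simp_all
    then have "(ad L x ^^ (a + b)) (u \<oplus> v) = \<zero>" using ab x by (simp add: ad_pow_add)
    then show "u \<oplus> v \<in> K" unfolding K_def using ab by auto
    have "(ad L x ^^ (a + b)) (u \<bullet> v) = \<zero>" using ad_pow_bracket_vanish ab x by blast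
    then show "u \<bullet> v \<in> K" unfolding K_def using ab by auto
  next
    fix c u assume "u \<in> K"
    then obtain k where "u \<in> C" "(ad L x ^^ k) u = \<zero>" unfolding K_def by blast
    then show "c \<odot> u \<in> K" unfolding K_def using x by (auto simp: ad_pow_scale intro!: exI[of _ k])
  qed (use x in \<open>auto simp: K_def\<close>)
  have "K = C"
  proof (rule ccontr)
    assume "K \<noteq> C"
    then obtain M where M: "max_subalg L M" "K \<subseteq> M"
      using max_subalg_exists[OF \<open>subalgebra L K\<close>] by blast
    then have sM: "subspace L M" unfolding max_subalg_def using subalgebra_subspace by blast
    have "C \<subseteq> M"
    proof
      fix y assume "y \<in> C"
      then obtain d e where "d \<in> K" "e \<in> frattini L" "y = d \<oplus> e" using dec by blast
      then show "y \<in> M" using M frattini_sub[OF M(1)] subspace_add[OF sM] by blast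
    qed
    then show False using M subspace_sub[OF sM] unfolding max_subalg_def by blast
  qed
  \<comment> \<open>So far each \<open>y\<close> is killed by a power depending on \<open>y\<close>.
    The kernels increase and become stationary, which yields one exponent for all.\<close>
  define g where "g k = {y \<in> C. (ad L x ^^ k) y = \<zero>}" for k
  have gs: "subspace L (g k)" for k
    using x unfolding g_def by (intro subspaceI) (auto simp: ad_pow_add ad_pow_scale)
  have gi: "g k \<subseteq> g (Suc k)" for k
    using ad_pow_vanish_mono[OF x, of k "Suc k"] unfolding g_def by auto
  obtain k where k: "\<forall>m. g m \<subseteq> g k" using increasing_stabilises[of g, OF gs gi] .
  have "y \<in> g k" if "y \<in> C" for y
  proof -
    have "y \<in> K" using that \<open>K = C\<close> by simp
    then obtain j where "(ad L x ^^ j) y = \<zero>" unfolding K_def by blast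
    then show ?thesis using that k unfolding g_def by blast
  qed
  then show ?thesis unfolding acts_nil_def g_def by blast
qed

end

subsection \<open>Algebras all of whose proper subalgebras are triangulable\<close>

locale min_nontriang = fd_lie L for L :: "('k::field, 'a) lie_alg" +
  assumes proper: "subalgebra L S \<Longrightarrow> S \<noteq> lcarrier L \<Longrightarrow> triang_on L S"
    and nontriang: "\<not> triangulable L"
begin

text \<open>A minimal counterexample \<open>I\<close> satisfies \<open>[I, I] \<le> \<phi>(L)\<close>, since \<open>I\<close> is not perfect by Engel's
  theorem. If \<open>M\<close> is a maximal subalgebra with \<open>L = I + M\<close> then \<open>[L, L] \<le> I + [M, M]\<close>, and an
  element \<open>i + m\<close> of the latter acts on \<open>L / I\<close> and on \<open>I / \<phi>(L)\<close> as the nilpotent \<open>m\<close>.\<close>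

theorem proper_ideal_le_frattini:
  assumes "ideal L I0" "I0 \<noteq> C"
  shows "I0 \<subseteq> frattini L"
proof (rule ccontr)
  assume "\<not> I0 \<subseteq> frattini L"
  define P where "P I \<longleftrightarrow> ideal L I \<and> I \<noteq> C \<and> \<not> I \<subseteq> frattini L" for I
  have "P I0" "\<And>U. P U \<Longrightarrow> subspace L U"
    using assms \<open>\<not> I0 \<subseteq> frattini L\<close> ideal_subspace unfolding P_def by auto
  from minimal_subspace_exists[of P, OF this]
  obtain I where "P I" and min: "\<And>V. P V \<Longrightarrow> V \<subseteq> I \<Longrightarrow> V = I" by metis
  then have I: "ideal L I" "I \<noteq> C" "\<not> I \<subseteq> frattini L" unfolding P_def by auto
  note Is = ideal_subspace[OF I(1)] and Isub = ideal_subalgebra[OF I(1)]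
  obtain M where M: "max_subalg L M" "\<not> I \<subseteq> M" using frattini_greatest I by blast
  have Ms: "subalgebra L M" "M \<noteq> C" using M(1) unfolding max_subalg_def by auto
  note Mss = subalgebra_subspace[OF Ms(1)]
  have "M \<subseteq> ssum I M" "I \<subseteq> ssum I M"
    using ssum_right[OF Is Mss] ssum_left[OF Is Mss] by auto
  then have IM: "ssum I M = C"
    using M ssum_subalgebra[OF I(1) Ms(1)] unfolding max_subalg_def by blast
  let ?I2 = "brspan L I I" and ?M2 = "brspan L M M"
  have I2: "ideal L ?I2" using brspan_ideal[OF I(1) I(1)] .
  have I2I: "?I2 \<subseteq> I" using subalgebra_br[OF Isub] by (intro brspan_least Is) auto
  have "?I2 \<noteq> I"
  proof
    assume eq: "?I2 = I"
    have "nilset I"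
      using proper[OF Isub I(2)] eq subalgebra_br[OF Isub] unfolding triang_on_def
      by (intro bracket_closed_nilset ideal_sub I(1)) auto
    then have "I = {\<zero>}" using nilset_fixed[of I I] ideal_sub[OF I(1)] Is eq by simp
    then show False using I(3) subspace_0[OF ideal_subspace[OF frattini_ideal]] by simp
  qed
  then have "\<not> P ?I2" using min I2I by blast
  moreover have "?I2 \<noteq> C" using I2I ideal_sub[OF I(1)] I(2) by auto
  ultimately have I2phi: "?I2 \<subseteq> frattini L" using I2 unfolding P_def by blast
  have M2: "subspace L ?M2" using subalgebra_sub[OF Ms(1)] by simp
  have "acts_nil L x" if x: "x \<in> brspan L C C" for x
  proof -
    have "brspan L C C \<subseteq> ssum I ?M2"
    proof (rule brspan_least)
      show "subspace L (ssum I ?M2)" using Is M2 by (rule ssum_subspace)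
      fix a b assume ab: "a \<in> C" "b \<in> C"
      then obtain i m j n where im: "i \<in> I" "m \<in> M" "a = i \<oplus> m" and jn: "j \<in> I" "n \<in> M" "b = j \<oplus> n"
        using IM unfolding ssum_def by blast
      have [simp]: "i \<in> C" "j \<in> C" "m \<in> C" "n \<in> C"
        using im jn ideal_sub[OF I(1)] subalgebra_sub[OF Ms(1)] by auto
      have "a \<bullet> b = (i \<bullet> b \<oplus> m \<bullet> j) \<oplus> m \<bullet> n"
        unfolding im jn by (simp add: br_add_left br_add_right add_ac)
      moreover have "i \<bullet> b \<oplus> m \<bullet> j \<in> I"
        using subspace_add[OF Is ideal_br_left[OF I(1) im(1) ab(2)] ideal_br[OF I(1) _ jn(1)]] by simp
      ultimately show "a \<bullet> b \<in> ssum I ?M2"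
        using ssumI[of "i \<bullet> b \<oplus> m \<bullet> j" I "m \<bullet> n" ?M2] brspanI[OF im(2) jn(2)] by simp
    qed
    then obtain i m where im: "i \<in> I" "m \<in> ?M2" "x = i \<oplus> m" using x unfolding ssum_def by blast
    have "i \<in> C" "m \<in> C"
      using im ideal_sub[OF I(1)] subspace_sub[OF M2] by auto
    then have C: "i \<in> C" "m \<in> C" "x \<in> C" using im(3) by simp_all
    have "acts_nil L m" using proper[OF Ms] im(2) unfolding triang_on_def by blast
    then obtain N where N: "\<And>y. y \<in> C \<Longrightarrow> (ad L m ^^ N) y = \<zero>" unfolding acts_nil_def by blast
    have phiC: "frattini L \<subseteq> C" using ideal_sub[OF frattini_ideal] .
    have toI: "(ad L x ^^ N) y \<in> I" if y: "y \<in> C" for y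
    proof -
      obtain j where "j \<in> I" "(ad L x ^^ N) y = j \<oplus> (ad L m ^^ N) y"
        using ad_pow_perturb[OF I(1) subset_refl C(1,2) br_closed[OF C(2)] ideal_br_left[OF I(1) im(1)] y]
        unfolding im(3) by blast
      then show ?thesis using N[OF y] ideal_sub[OF I(1)] by auto
    qed
    have tophi: "(ad L x ^^ N) y \<in> frattini L" if y: "y \<in> I" for y
    proof -
      have "i \<bullet> t \<in> frattini L" if "t \<in> I" for t
        using I2phi brspanI[OF im(1) that] by blast
      then obtain j where "j \<in> frattini L" "(ad L x ^^ N) y = j \<oplus> (ad L m ^^ N) y"
        using ad_pow_perturb[OF frattini_ideal ideal_sub[OF I(1)] C(1,2) ideal_br[OF I(1) C(2)] _ y]
        unfolding im(3) by blast
      moreover have "y \<in> C" using y ideal_sub[OF I(1)] by blast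
      ultimately show ?thesis using N phiC by auto
    qed
    show ?thesis
    proof (rule acts_nil_if_nil_mod_frattini[OF C(3)])
      fix y assume "y \<in> C"
      then show "(ad L x ^^ (N + N)) y \<in> frattini L"
        \<comment> \<open>The first \<open>N\<close> applications move \<open>L\<close> into
          \<open>I\<close>, the next \<open>N\<close> move \<open>I\<close> into
          \<open>frattini L\<close>.\<close>
        using tophi[OF toI] by (simp add: funpow_add)
    qed
  qed
  then show False using nontriang unfolding triangulable_def triang_on_def by blast
qed

lemma two_gen_carr: "two_gen L C"
proof (rule ccontr)
  assume "\<not> two_gen L C"
  then have "triang_on L T" if "subalgebra L T" "two_gen L T" for T
    using that by (cases "T = C") (auto intro: proper)
  then have "triang_on L C"
    by (rule triang_on_if_two_gen[OF subalgebra_carr])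
  then show False using nontriang unfolding triangulable_def by blast
qed

text \<open>Otherwise a single application of \<open>ad L x\<close>, for \<open>x\<close> in the
  derived algebra, ends in \<open>frattini L\<close>; by the Fitting argument \<open>x\<close> acts
  nilpotently and \<open>L\<close> is triangulable. This is what makes \<open>L / phi(L)\<close>
  non-abelian and \<open>L\<close> perfect.\<close>

lemma brspan_not_le_frattini: "\<not> brspan L C C \<subseteq> frattini L"
proof
  assume le: "brspan L C C \<subseteq> frattini L"
  have "acts_nil L x" if x: "x \<in> brspan L C C" for x
  proof (rule acts_nil_if_nil_mod_frattini[where n = 1])
    show xC: "x \<in> C" using x le ideal_sub[OF frattini_ideal] by blast
    show "(ad L x ^^ 1) y \<in> frattini L" if "y \<in> C" for y
      using ideal_br_left[OF frattini_ideal _ that, of x] x le by (auto simp: ad_apply)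
  qed
  then show False using nontriang unfolding triangulable_def triang_on_def by blast
qed

lemma not_solvable: "\<not> solvable L"
proof
  have "brspan L C C = C"
    using proper_ideal_le_frattini[OF brspan_ideal[OF ideal_carr ideal_carr]] brspan_not_le_frattini
    by blast
  then have "derived L n = C" for n by (induction n) auto
  moreover assume "solvable L"
  ultimately have "C = {\<zero>}" unfolding solvable_def by auto
  then have "brspan L C C \<subseteq> {\<zero>}"
    using brspan_subspace[of C C] subspace_sub by blast
  then show False
    using brspan_not_le_frattini subspace_0[OF ideal_subspace[OF frattini_ideal]] by blast
qed

end

subsection \<open>The simple case\<close>

text \<open>An abstract setting into which the quotient is plugged later, so that (a)-(c) are proved
  with elements instead of cosets.\<close>

locale simple_min_nontriang = fd_lie L for L :: "('k::field, 'a) lie_alg" +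
  assumes proper: "subalgebra L S \<Longrightarrow> S \<noteq> lcarrier L \<Longrightarrow> triang_on L S"
    and simple: "simple L"
begin

lemma ideal_cases: "ideal L I \<Longrightarrow> I = {\<zero>} \<or> I = C"
  using simple unfolding simple_def by blast

lemma nil_subalg_nilset: "nil_subalg L S \<Longrightarrow> nilset S"
  unfolding nil_subalg_def
  using bracket_closed_nilset[of S] subalgebra_sub subalgebra_br by blast

text \<open>Otherwise \<open>C\<close> is a \<open>nilset\<close>. By simplicity
  \<open>brspan L C C\<close> is zero or \<open>C\<close>; the latter is a fixed subspace, hence
  zero. Both make \<open>L\<close> abelian.\<close>

lemma nil_subalg_proper:
  assumes "nil_subalg L S"
  shows "S \<noteq> C"
proof
  assume "S = C"
  then have n: "nilset C" using assms nil_subalg_nilset by simp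
  have "ideal L (brspan L C C)" using brspan_ideal by simp
  then consider "brspan L C C = {\<zero>}" | "brspan L C C = C" using ideal_cases by blast
  then show False
  proof cases
    case 1
    then have "abelian L C" using brspanI[of _ C _ C] unfolding abelian_def by blast
    then show False using simple unfolding simple_def by blast
  next
    case 2
    then have "C = {\<zero>}" using nilset_fixed[OF n subset_refl subspace_carr] by simp
    then have "abelian L C" unfolding abelian_def by auto
    then show False using simple unfolding simple_def by blast
  qed
qed

lemma nil_nil_subalg:
  assumes S: "subalgebra L S" "S \<noteq> C"
  shows "nil_subalg L (nil L S)"
  using nil_elements_ideal[OF S(1) proper[OF S]]
  unfolding nil_eq[OF S(1) proper[OF S]] nil_subalg_def subalgebra_def ideal_of_def by blast

lemma normalizer_proper:
  assumes K: "nil_subalg L K" "K \<noteq> {\<zero>}"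
  shows "normalizer L K \<noteq> C"
proof
  assume "normalizer L K = C"
  then have "ideal L K"
    using K(1) subalgebra_subspace unfolding ideal_def nil_subalg_def normalizer_def by blast
  then show False using ideal_cases K nil_subalg_proper by blast
qed

lemma nil_subalg_escape:
  assumes T: "nil_subalg L T" and D: "subalgebra L D" "D \<subset> T"
  obtains u where "u \<in> T" "u \<notin> D" "u \<in> normalizer L D" "acts_nil L u"
proof -
  have Ts: "subalgebra L T" and TC: "T \<subseteq> C"
    using T subalgebra_sub unfolding nil_subalg_def by auto
  have nD: "nilset D" using nilset_mono[OF nil_subalg_nilset[OF T] _ TC] D(2) by blast
  obtain w where w: "w \<in> T" "w \<notin> D" using D(2) by blast
  have cl: "a \<bullet> t \<in> T" if "a \<in> D" "t \<in> T" for a t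
    using that D(2) subalgebra_br[OF Ts] by blast
  obtain u where u: "u \<in> T" "u \<notin> D" "\<forall>a\<in>D. a \<bullet> u \<in> D"
    using nilset_escape[OF nD subalgebra_sub[OF D(1)] w TC cl
        subspace_0[OF subalgebra_subspace[OF D(1)]]] by blast
  have "u \<bullet> a \<in> D" if a: "a \<in> D" for a
  proof -
    have "u \<bullet> a = (-1) \<odot> (a \<bullet> u)"
      using a u(1) TC subalgebra_sub[OF D(1)] by (intro br_anti) auto
    then show ?thesis using subspace_scale[OF subalgebra_subspace[OF D(1)]] u(3) a by simp
  qed
  then have "u \<in> normalizer L D" using u(1) TC unfolding normalizer_def by blast
  moreover have "acts_nil L u" using u(1) T unfolding nil_subalg_def by blast
  ultimately show thesis using that u by blast
qed

lemma max_subalgD: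
  assumes "max_subalg L M"
  shows "subalgebra L M" "M \<noteq> C" "nil L M = {x \<in> M. acts_nil L x}" "nil_subalg L (nil L M)"
  using assms nil_eq[OF _ proper] nil_nil_subalg unfolding max_subalg_def by auto

text \<open>\<open>nil L M\<close> is an ideal of \<open>M\<close>, so its normaliser contains
  \<open>M\<close>; being a proper subalgebra, it is \<open>M\<close> by maximality. Hence
  \<open>M\<close> can be recovered from \<open>nil L M\<close>.\<close>

lemma normalizer_nil:
  assumes M: "max_subalg L M" and nz: "nil L M \<noteq> {\<zero>}"
  shows "normalizer L (nil L M) = M"
proof -
  note D = max_subalgD[OF M]
  have "M \<subseteq> normalizer L (nil L M)"
    using nil_elements_ideal[OF D(1) proper[OF D(1,2)]] subalgebra_sub[OF D(1)]
    unfolding D(3) ideal_of_def normalizer_def by blast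
  moreover have "subalgebra L (normalizer L (nil L M))"
    using D(4) subalgebra_subspace unfolding nil_subalg_def by (intro normalizer_subalgebra) blast
  moreover have "normalizer L (nil L M) \<noteq> C" using normalizer_proper[OF D(4) nz] .
  ultimately show ?thesis using M unfolding max_subalg_def by blast
qed

text \<open>A larger nil subalgebra would contain a new nil element normalising
  \<open>nil L M\<close>. It would lie in \<open>M\<close>, hence in \<open>nil L M\<close>.\<close>

lemma max_nil_nil:
  assumes M: "max_subalg L M" and nz: "nil L M \<noteq> {\<zero>}"
  shows "max_nil L (nil L M)"
proof (rule ccontr)
  note D = max_subalgD[OF M]
  assume "\<not> max_nil L (nil L M)"
  then obtain K where K: "nil_subalg L K" "nil L M \<subset> K"
    using D(4) unfolding max_nil_def by blast
  have "subalgebra L (nil L M)" using D(4) unfolding nil_subalg_def by blast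
  then obtain u where "u \<in> K" "u \<notin> nil L M" "u \<in> normalizer L (nil L M)" "acts_nil L u"
    using nil_subalg_escape[OF K(1) _ K(2)] by blast
  then show False using normalizer_nil[OF M nz] D(3) by auto
qed

lemma max_subalg_cases:
  assumes M: "max_subalg L M"
  shows "(abelian L M \<and> (\<forall>x\<in>M. x \<noteq> \<zero> \<longrightarrow> \<not> acts_nil L x)) \<or> (nil L M \<noteq> {\<zero>} \<and> max_nil L (nil L M))"
proof (cases "nil L M = {\<zero>}")
  case True
  note D = max_subalgD[OF M]
  have *: "x = \<zero>" if "x \<in> M" "acts_nil L x" for x
    using True D(3) that by blast
  have "x \<bullet> y = \<zero>" if "x \<in> M" "y \<in> M" for x y
    using proper[OF D(1,2)] brspanI[of x M y M] that subalgebra_br[OF D(1)]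
    unfolding triang_on_def by (intro *) auto
  then show ?thesis using * unfolding abelian_def by blast
qed (use max_nil_nil[OF M] in blast)

text \<open>A maximal subalgebra \<open>M\<close> above the normaliser contains \<open>K\<close>
  among its nil elements, so \<open>nil L M = K\<close> by maximality of \<open>K\<close>, and the
  normaliser of \<open>K\<close> is \<open>M\<close>.\<close>

lemma normalizer_max_nil:
  assumes K: "max_nil L K" "K \<noteq> {\<zero>}"
  shows "max_subalg L (normalizer L K)"
proof -
  have nK: "nil_subalg L K" using K unfolding max_nil_def by blast
  then have Ks: "subalgebra L K" unfolding nil_subalg_def by blast
  obtain M where M: "max_subalg L M" "normalizer L K \<subseteq> M"
    using max_subalg_exists[OF normalizer_subalgebra[OF subalgebra_subspace[OF Ks]]
        normalizer_proper[OF nK K(2)]] .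
  note D = max_subalgD[OF M(1)]
  have "K \<subseteq> nil L M"
    using normalizer_superset[OF Ks] M(2) nK unfolding D(3) nil_subalg_def by blast
  then have "nil L M = K" using K(1) D(4) unfolding max_nil_def by blast
  then show ?thesis using normalizer_nil[OF M(1)] K(2) M(1) by simp
qed

text \<open>Among pairs of distinct maximal subalgebras whose intersection contains nonzero nil elements
  choose one where the set \<open>D\<close> of these elements is maximal. A maximal subalgebra containing
  the normaliser of \<open>D\<close> meets both members of the pair in more nil elements.\<close>

lemma max_subalg_Int_nil:
  assumes M: "max_subalg L M1" "max_subalg L M2" "M1 \<noteq> M2"
    and x: "x \<in> M1 \<inter> M2" "x \<noteq> \<zero>"
  shows "\<not> acts_nil L x"
proof
  assume nx: "acts_nil L x"
  define P where "P D \<longleftrightarrow> D \<noteq> {\<zero>} \<and>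
    (\<exists>A B. max_subalg L A \<and> max_subalg L B \<and> A \<noteq> B \<and> D = nil L A \<inter> nil L B)" for D
  have "x \<in> nil L M1 \<inter> nil L M2"
    using x nx max_subalgD(3)[OF M(1)] max_subalgD(3)[OF M(2)] by blast
  then have "P (nil L M1 \<inter> nil L M2)" using M x(2) unfolding P_def by blast
  moreover have Psub: "subalgebra L D" if "P D" for D
    using that max_subalgD(4) subalgebra_Int unfolding P_def nil_subalg_def by blast
  then have "subspace L D" if "P D" for D using that subalgebra_subspace by blast
  ultimately obtain D where D: "P D" and max: "\<And>V. P V \<Longrightarrow> D \<subseteq> V \<Longrightarrow> V = D"
    using maximal_subspace_exists[of P] by metis
  then obtain A B where A: "max_subalg L A" and B: "max_subalg L B" and AB: "A \<noteq> B"
    and Deq: "D = nil L A \<inter> nil L B" and Dnz: "D \<noteq> {\<zero>}"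
    unfolding P_def by blast
  have Ds: "subalgebra L D" using Psub[OF D] .
  note DA = max_subalgD[OF A] and DB = max_subalgD[OF B]
  have nD: "nil_subalg L D" using Ds DA(4) unfolding nil_subalg_def Deq by blast
  have D0: "\<zero> \<in> D" using subspace_0[OF subalgebra_subspace[OF Ds]] .
  then have nz: "nil L A \<noteq> {\<zero>}" "nil L B \<noteq> {\<zero>}" using Dnz Deq by auto
  have ne: "nil L A \<noteq> nil L B"
    using normalizer_nil[OF A nz(1)] normalizer_nil[OF B nz(2)] AB by metis
  have mA: "max_nil L (nil L A)" and mB: "max_nil L (nil L B)"
    using max_nil_nil A B nz by auto
  \<comment> \<open>If \<open>D\<close> were one of the two nil subalgebras, that one would lie in
    the other and equal it by maximality, against \<open>ne\<close>.\<close>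
  have DsubA: "D \<subset> nil L A" and DsubB: "D \<subset> nil L B"
    using mA mB ne DA(4) DB(4) unfolding Deq max_nil_def by blast+
  obtain E where E: "max_subalg L E" "normalizer L D \<subseteq> E"
    using max_subalg_exists[OF normalizer_subalgebra[OF subalgebra_subspace[OF Ds]]
        normalizer_proper[OF nD Dnz]] .
  have DE: "D \<subseteq> nil L E"
    using normalizer_superset[OF Ds] E(2) nD unfolding max_subalgD(3)[OF E(1)] nil_subalg_def by blast
  have "E = F" if F: "max_subalg L F" "D \<subset> nil L F" for F
  proof (rule ccontr)
    assume EF: "E \<noteq> F"
    obtain u where u: "u \<in> nil L F" "u \<notin> D" "u \<in> normalizer L D" "acts_nil L u"
      using nil_subalg_escape[OF max_subalgD(4)[OF F(1)] Ds F(2)] .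
    have uE: "u \<in> nil L E" using u E(2) unfolding max_subalgD(3)[OF E(1)] by blast
    have "nil L E \<inter> nil L F \<noteq> {\<zero>}" using u(1,2) uE D0 by (metis IntI singletonD)
    then have "P (nil L E \<inter> nil L F)" using E(1) F(1) EF unfolding P_def by blast
    then have "nil L E \<inter> nil L F = D" using max DE F(2) by blast
    then show False using u uE by blast
  qed
  then have "E = A" "E = B" using A B DsubA DsubB by auto
  then show False using AB by simp
qed

lemma max_subalg_Int_abelian:
  assumes M: "max_subalg L M1" "max_subalg L M2" "M1 \<noteq> M2"
  shows "abelian L (M1 \<inter> M2)"
  unfolding abelian_def
proof (intro ballI)
  fix x y assume xy: "x \<in> M1 \<inter> M2" "y \<in> M1 \<inter> M2"
  note D1 = max_subalgD[OF M(1)] and D2 = max_subalgD[OF M(2)]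
  have "x \<bullet> y \<in> M1 \<inter> M2" using xy subalgebra_br[OF D1(1)] subalgebra_br[OF D2(1)] by blast
  moreover have "acts_nil L (x \<bullet> y)"
    using xy proper[OF D1(1,2)] brspanI[of x M1 y M1] unfolding triang_on_def by blast
  ultimately show "x \<bullet> y = \<zero>" using max_subalg_Int_nil[OF M] by blast
qed

end

subsection \<open>Quotients\<close>

text \<open>Transfer along surjective homomorphisms needs no coset representatives; these are
  confined to \<open>quot_epi\<close>. The Lie axioms of the target follow from those of
  \<open>L\<close>.\<close>

locale lie_epi = lie L for L :: "('k::field, 'a) lie_alg" +
  fixes L' :: "('k, 'b) lie_alg" and f :: "'a \<Rightarrow> 'b"
  assumes image_carr: "lcarrier L' = f ` lcarrier L"
    and f_zero: "lzero L' = f (lzero L)"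
    and f_add: "x \<in> lcarrier L \<Longrightarrow> y \<in> lcarrier L \<Longrightarrow> ladd L' (f x) (f y) = f (ladd L x y)"
    and f_scale: "x \<in> lcarrier L \<Longrightarrow> lsmult L' c (f x) = f (lsmult L c x)"
    and f_br: "x \<in> lcarrier L \<Longrightarrow> y \<in> lcarrier L \<Longrightarrow> lbr L' (f x) (f y) = f (lbr L x y)"
begin

abbreviation pre :: "'b set \<Rightarrow> 'a set" where
  "pre T \<equiv> {x \<in> C. f x \<in> T}"

lemma lie_algebra_target: "lie_algebra L'"
  unfolding lie_algebra_def image_carr f_zero
proof (intro conjI)
  show "\<forall>x\<in>f ` C. \<exists>y\<in>f ` C. ladd L' x y = f \<zero>"
    using inverse_exists f_add by (metis (no_types, lifting) image_iff)
  show "\<forall>x\<in>f ` C. \<forall>y\<in>f ` C. ladd L' x y = ladd L' y x"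
    by (auto simp: f_add add_commute)
qed (auto simp: f_add f_scale f_br add_assoc scale_add add_scale br_add_left br_add_right jacobi)

sublocale target: lie L'
  by unfold_locales (rule lie_algebra_target)

lemma f_pre: "T \<subseteq> lcarrier L' \<Longrightarrow> f ` pre T = T"
  unfolding image_carr by auto

lemma subspace_pre:
  assumes T: "subspace L' T"
  shows "subspace L (pre T)"
  using target.subspace_0[OF T] target.subspace_add[OF T] target.subspace_scale[OF T]
  by (intro subspaceI) (auto simp: f_zero simp flip: f_add f_scale)

lemma subspace_image:
  assumes U: "subspace L U"
  shows "subspace L' (f ` U)"
proof (rule target.subspaceI)
  have UC: "x \<in> C" if "x \<in> U" for x using that subspace_mem[OF U] by blast
  then show "f ` U \<subseteq> lcarrier L'" unfolding image_carr by blast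
  show "lzero L' \<in> f ` U" unfolding f_zero using subspace_0[OF U] by blast
  show "ladd L' x y \<in> f ` U" if "x \<in> f ` U" "y \<in> f ` U" for x y
    using that UC subspace_add[OF U] by (auto simp: f_add)
  show "lsmult L' c x \<in> f ` U" if "x \<in> f ` U" for c x
    using that UC subspace_scale[OF U] by (auto simp: f_scale)
qed

lemma subalgebra_pre:
  assumes "subalgebra L' T"
  shows "subalgebra L (pre T)"
  using assms subspace_pre unfolding subalgebra_def by (auto simp flip: f_br)

lemma ideal_pre:
  assumes "ideal L' J"
  shows "ideal L (pre J)"
  using assms subspace_pre unfolding ideal_def image_carr by (auto simp flip: f_br)

lemma f_ad_pow: "x \<in> C \<Longrightarrow> y \<in> C \<Longrightarrow> (ad L' (f x) ^^ n) (f y) = f ((ad L x ^^ n) y)"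
  by (induction n) (auto simp: ad_apply target.ad_apply f_br)

lemma acts_nil_image:
  assumes "acts_nil L x" "x \<in> C"
  shows "acts_nil L' (f x)"
  using assms unfolding acts_nil_def image_carr f_zero by (metis f_ad_pow imageE)

lemma triang_on_image:
  assumes T: "T \<subseteq> lcarrier L'" and tr: "triang_on L (pre T)"
  shows "triang_on L' T"
proof -
  let ?B = "brspan L (pre T) (pre T)"
  have B: "subspace L ?B" by (intro brspan_subspace) auto
  have "brspan L' T T \<subseteq> f ` ?B"
  proof (rule target.brspan_least[OF subspace_image[OF B]])
    fix a b assume "a \<in> T" "b \<in> T"
    then obtain x y where "x \<in> pre T" "y \<in> pre T" "a = f x" "b = f y"
      using f_pre[OF T] by (metis (no_types, lifting) image_iff)
    then show "lbr L' a b \<in> f ` ?B" using brspanI[of x "pre T" y "pre T"] by (simp add: f_br)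
  qed
  moreover have "acts_nil L' (f x)" if "x \<in> ?B" for x
  proof (rule acts_nil_image)
    show "acts_nil L x" using that tr unfolding triang_on_def by blast
  qed (rule subspace_mem[OF B that])
  ultimately show ?thesis unfolding triang_on_def by blast
qed

lemma fin_dim_image:
  assumes "fin_dim L"
  shows "fin_dim L'"
proof -
  obtain S where S: "finite S" "S \<subseteq> C" "span L S = C" using assms unfolding fin_dim_def by blast
  have sub: "f ` S \<subseteq> lcarrier L'" using S(2) unfolding image_carr by blast
  have V: "subspace L' (span L' (f ` S))" using target.span_subspace[OF sub] .
  have "S \<subseteq> pre (span L' (f ` S))" using S(2) target.span_superset[of "f ` S"] by blast
  then have "C \<subseteq> pre (span L' (f ` S))" using span_least[OF subspace_pre[OF V]] S(3) by blast
  then have "span L' (f ` S) = lcarrier L'"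
    using target.subspace_sub[OF V] unfolding image_carr by blast
  then show ?thesis unfolding fin_dim_def using S(1) sub by blast
qed

lemma two_gen_image:
  assumes "two_gen L C"
  shows "two_gen L' (lcarrier L')"
proof -
  obtain x y where xy: "x \<in> C" "y \<in> C" "gen L {x, y} = C" using assms unfolding two_gen_def by blast
  have G: "subalgebra L' (gen L' {f x, f y})"
    using xy by (intro target.gen_subalgebra) (auto simp: image_carr)
  have "{x, y} \<subseteq> pre (gen L' {f x, f y})" using xy target.gen_superset[of "{f x, f y}"] by blast
  then have "C \<subseteq> pre (gen L' {f x, f y})" using gen_least[OF subalgebra_pre[OF G]] xy(3) by blast
  then have "gen L' {f x, f y} = lcarrier L'"
    using target.subalgebra_sub[OF G] unfolding image_carr by blast
  then show ?thesis unfolding two_gen_def image_carr using xy by blast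
qed

end

context lie
begin

lemma coset_shift:
  assumes I: "subspace L I" and x: "x \<in> C" and i: "i \<in> I"
  shows "coset L I (x \<oplus> i) = coset L I x"
proof
  note IC = subspace_mem[OF I]
  show "coset L I (x \<oplus> i) \<subseteq> coset L I x"
    using x i IC subspace_add[OF I i] unfolding coset_def by (auto simp: add_assoc)
  show "coset L I x \<subseteq> coset L I (x \<oplus> i)"
  proof
    fix y assume "y \<in> coset L I x"
    then obtain j where j: "j \<in> I" "y = x \<oplus> j" unfolding coset_def by blast
    then have "y = (x \<oplus> i) \<oplus> ((-1) \<odot> i \<oplus> j)" using x i IC by (simp add: add_assoc)
    moreover have "(-1) \<odot> i \<oplus> j \<in> I" using i j subspace_add[OF I] subspace_scale[OF I] by blast
    ultimately show "y \<in> coset L I (x \<oplus> i)" unfolding coset_def by blast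
  qed
qed

lemma rep_coset:
  assumes I: "subspace L I"
  obtains i where "i \<in> I" "rep (coset L I x) = x \<oplus> i"
proof -
  have "x \<oplus> \<zero> \<in> coset L I x" using subspace_0[OF I] unfolding coset_def by blast
  then have "rep (coset L I x) \<in> coset L I x" unfolding rep_def by (rule someI)
  then show thesis using that unfolding coset_def by blast
qed

lemma coset_eq_zero_iff:
  assumes I: "subspace L I" and x: "x \<in> C"
  shows "coset L I x = coset L I \<zero> \<longleftrightarrow> x \<in> I"
proof
  assume "x \<in> I"
  then show "coset L I x = coset L I \<zero>" using coset_shift[OF I zero_closed, of x] x by simp
next
  assume eq: "coset L I x = coset L I \<zero>"
  have "x \<oplus> \<zero> \<in> coset L I \<zero>"
    unfolding eq[symmetric] unfolding coset_def using subspace_0[OF I] by blast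
  then obtain i where "i \<in> I" "x \<oplus> \<zero> = \<zero> \<oplus> i" by (auto simp: coset_def)
  then show "x \<in> I" using x subspace_mem[OF I] by auto
qed

text \<open>The operations of \<open>quot\<close> use chosen representatives
  \<open>x \<oplus> i\<close> and \<open>y \<oplus> j\<close>. In each operation the resulting error
  term lies in \<open>I\<close> and is absorbed by \<open>coset_shift\<close>.\<close>

lemma quot_epi:
  assumes "ideal L I"
  shows "lie_epi L (quot L I) (coset L I)"
proof unfold_locales
  have I: "subspace L I" using assms unfolding ideal_def by blast
  note IC = subspace_mem[OF I]
  show "lcarrier (quot L I) = coset L I ` C" "lzero (quot L I) = coset L I \<zero>"
    by (simp_all add: quot_def)
  fix x y c assume x: "x \<in> C"
  obtain i where i: "i \<in> I" "rep (coset L I x) = x \<oplus> i" using rep_coset[OF I] .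
  show "lsmult (quot L I) c (coset L I x) = coset L I (c \<odot> x)"
    using x i IC coset_shift[OF I _ subspace_scale[OF I i(1)], of "c \<odot> x" c]
    by (simp add: quot_def scale_add)
  assume y: "y \<in> C"
  obtain j where j: "j \<in> I" "rep (coset L I y) = y \<oplus> j" using rep_coset[OF I] .
  have C [simp]: "x \<in> C" "y \<in> C" "i \<in> C" "j \<in> C" using x y i j IC by auto
  have "(x \<oplus> i) \<oplus> (y \<oplus> j) = (x \<oplus> y) \<oplus> (i \<oplus> j)" by (simp add: add_ac)
  then show "ladd (quot L I) (coset L I x) (coset L I y) = coset L I (x \<oplus> y)"
    using coset_shift[OF I _ subspace_add[OF I i(1) j(1)], of "x \<oplus> y"] i(2) j(2)
    by (simp add: quot_def)
  have "(x \<oplus> i) \<bullet> (y \<oplus> j) = x \<bullet> y \<oplus> (x \<bullet> j \<oplus> i \<bullet> (y \<oplus> j))"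
    by (simp add: br_add_left br_add_right add_ac)
  moreover have "i \<bullet> (y \<oplus> j) = (-1) \<odot> ((y \<oplus> j) \<bullet> i)" by (rule br_anti) simp_all
  then have "x \<bullet> j \<oplus> i \<bullet> (y \<oplus> j) \<in> I"
    using assms i(1) j(1) subspace_add[OF I] subspace_scale[OF I] unfolding ideal_def by simp
  ultimately show "lbr (quot L I) (coset L I x) (coset L I y) = coset L I (x \<bullet> y)"
    using coset_shift[OF I, of "x \<bullet> y"] i(2) j(2) by (simp add: quot_def)
qed

end

section \<open>The quotient by the Frattini ideal\<close>

sublocale min_nontriang \<subseteq> q: lie_epi L "quot L (frattini L)" "coset L (frattini L)"
  by (rule quot_epi[OF frattini_ideal])

text \<open>Everything is pulled back to \<open>L\<close>: proper subalgebras have proper preimages,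
  and a proper ideal has its preimage inside \<open>frattini L\<close>, hence is zero.\<close>

sublocale min_nontriang \<subseteq> Lb: simple_min_nontriang "quot L (frattini L)"
proof unfold_locales
  let ?Lb = "quot L (frattini L)" and ?f = "coset L (frattini L)"
  note phi = ideal_subspace[OF frattini_ideal]
  show "fin_dim ?Lb" using q.fin_dim_image[OF fin_dim] .
  show "triang_on ?Lb S" if S: "subalgebra ?Lb S" "S \<noteq> lcarrier ?Lb" for S
  proof (rule q.triang_on_image)
    show SC: "S \<subseteq> lcarrier ?Lb" using q.target.subspace_sub S(1) unfolding subalgebra_def by blast
    have "q.pre S \<noteq> C" using q.f_pre[OF SC] S(2) q.image_carr by metis
    then show "triang_on L (q.pre S)" using proper q.subalgebra_pre[OF S(1)] by blast
  qed
  show "simple ?Lb"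
    unfolding simple_def
  proof (intro conjI allI impI notI)
    assume ab: "abelian ?Lb (lcarrier ?Lb)"
    have "x \<bullet> y \<in> frattini L" if "x \<in> C" "y \<in> C" for x y
    proof -
      have "lbr ?Lb (?f x) (?f y) = lzero ?Lb"
        using ab that unfolding abelian_def q.image_carr by blast
      then show ?thesis using that coset_eq_zero_iff[OF phi] by (simp add: q.f_br q.f_zero)
    qed
    then show False using brspan_least[OF phi] brspan_not_le_frattini by blast
  next
    fix J assume J: "ideal ?Lb J"
    then have JC: "J \<subseteq> lcarrier ?Lb" using q.target.subspace_sub unfolding ideal_def by blast
    show "J = {lzero ?Lb} \<or> J = lcarrier ?Lb"
    proof (cases "q.pre J = C")
      case True
      then show ?thesis using q.f_pre[OF JC] q.image_carr by metis
    next
      case False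
      then have "q.pre J \<subseteq> frattini L" using proper_ideal_le_frattini q.ideal_pre[OF J] by blast
      then have *: "?f x = lzero ?Lb" if "x \<in> q.pre J" for x
        using that coset_eq_zero_iff[OF phi] unfolding q.f_zero by blast
      have "J \<subseteq> {lzero ?Lb}"
      proof
        fix a assume a: "a \<in> J"
        then obtain x where x: "x \<in> C" "a = ?f x" using JC unfolding q.image_carr by blast
        then have "x \<in> q.pre J" using a by simp
        from *[OF this] show "a \<in> {lzero ?Lb}" using x(2) by simp
      qed
      moreover have "lzero ?Lb \<in> J" using q.target.subspace_0 J unfolding ideal_def by blast
      ultimately show ?thesis by blast
    qed
  qed
qed

theorem theorem4p6:
  fixes L :: "('k::field, 'a) lie_alg"
  assumes "lie_algebra L" and "fin_dim L"
  shows "(solvable L \<and>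
            (\<forall>S. subalgebra L S \<and> S \<noteq> lcarrier L \<and> two_gen L S \<longrightarrow> triang_on L S)
          \<longrightarrow> triangulable L)
       \<and> ((\<forall>S. subalgebra L S \<and> S \<noteq> lcarrier L \<longrightarrow> triang_on L S) \<and> \<not> triangulable L
          \<longrightarrow> (let Lb = quot L (frattini L) in
                two_gen L (lcarrier L) \<and> simple Lb
              \<and> (\<forall>M. max_subalg Lb M \<longrightarrow>
                    (abelian Lb M \<and> (\<forall>x\<in>M. x \<noteq> lzero Lb \<longrightarrow> \<not> acts_nil Lb x))
                  \<or> (nil Lb M \<noteq> {lzero Lb} \<and> max_nil Lb (nil Lb M)))
              \<and> (\<forall>K. max_nil Lb K \<and> K \<noteq> {lzero Lb} \<longrightarrow> max_subalg Lb (normalizer Lb K))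
              \<and> (\<forall>M1 M2. max_subalg Lb M1 \<and> max_subalg Lb M2 \<and> M1 \<noteq> M2 \<longrightarrow>
                    (\<forall>x\<in>M1 \<inter> M2. x \<noteq> lzero Lb \<longrightarrow> \<not> acts_nil Lb x) \<and> abelian Lb (M1 \<inter> M2))
              \<and> two_gen Lb (lcarrier Lb)))"
proof (intro conjI impI)
  interpret fd_lie L using assms by unfold_locales
  assume *: "solvable L \<and> (\<forall>S. subalgebra L S \<and> S \<noteq> lcarrier L \<and> two_gen L S \<longrightarrow> triang_on L S)"
  show "triangulable L"
  proof (rule ccontr)
    assume nt: "\<not> triangulable L"
    \<comment> \<open>The hypothesis on two-generated subalgebras is upgraded to all proper ones, so
      that a counterexample to (1) is a solvable \<open>min_nontriang\<close>.\<close>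
    have "triang_on L S" if S: "subalgebra L S" "S \<noteq> lcarrier L" for S
    proof (rule triang_on_if_two_gen[OF S(1)])
      fix T assume "subalgebra L T" "T \<subseteq> S" "two_gen L T"
      moreover from this have "T \<noteq> lcarrier L" using S subalgebra_sub by blast
      ultimately show "triang_on L T" using * by blast
    qed
    then interpret min_nontriang L using nt by unfold_locales
    show False using not_solvable * by blast
  qed
next
  assume *: "(\<forall>S. subalgebra L S \<and> S \<noteq> lcarrier L \<longrightarrow> triang_on L S) \<and> \<not> triangulable L"
  interpret min_nontriang L using assms * by unfold_locales auto
  show "let Lb = quot L (frattini L) in
                two_gen L (lcarrier L) \<and> simple Lb
              \<and> (\<forall>M. max_subalg Lb M \<longrightarrow>
                    (abelian Lb M \<and> (\<forall>x\<in>M. x \<noteq> lzero Lb \<longrightarrow> \<not> acts_nil Lb x))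
                  \<or> (nil Lb M \<noteq> {lzero Lb} \<and> max_nil Lb (nil Lb M)))
              \<and> (\<forall>K. max_nil Lb K \<and> K \<noteq> {lzero Lb} \<longrightarrow> max_subalg Lb (normalizer Lb K))
              \<and> (\<forall>M1 M2. max_subalg Lb M1 \<and> max_subalg Lb M2 \<and> M1 \<noteq> M2 \<longrightarrow>
                    (\<forall>x\<in>M1 \<inter> M2. x \<noteq> lzero Lb \<longrightarrow> \<not> acts_nil Lb x) \<and> abelian Lb (M1 \<inter> M2))
              \<and> two_gen Lb (lcarrier Lb)"
    unfolding Let_def
  proof (intro conjI allI impI ballI)
    let ?Lb = "quot L (frattini L)"
    show "two_gen L (lcarrier L)" by (rule two_gen_carr)
    show "simple ?Lb" by (rule Lb.simple)
    show "two_gen ?Lb (lcarrier ?Lb)" using q.two_gen_image[OF two_gen_carr] .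
    show "(abelian ?Lb M \<and> (\<forall>x\<in>M. x \<noteq> lzero ?Lb \<longrightarrow> \<not> acts_nil ?Lb x))
        \<or> (nil ?Lb M \<noteq> {lzero ?Lb} \<and> max_nil ?Lb (nil ?Lb M))" if "max_subalg ?Lb M" for M
      using that by (rule Lb.max_subalg_cases)
    show "max_subalg ?Lb (normalizer ?Lb K)" if "max_nil ?Lb K \<and> K \<noteq> {lzero ?Lb}" for K
      using that Lb.normalizer_max_nil by blast
    fix M1 M2 assume "max_subalg ?Lb M1 \<and> max_subalg ?Lb M2 \<and> M1 \<noteq> M2"
    then have M: "max_subalg ?Lb M1" "max_subalg ?Lb M2" "M1 \<noteq> M2" by auto
    show "abelian ?Lb (M1 \<inter> M2)" by (rule Lb.max_subalg_Int_abelian[OF M])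
    show "\<not> acts_nil ?Lb x" if "x \<in> M1 \<inter> M2" "x \<noteq> lzero ?Lb" for x
      using that by (rule Lb.max_subalg_Int_nil[OF M])
  qed
qed

end
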